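(* Let $F$ be a finitely generated free group which is not cyclic, let $\hat F=\varprojlim_i F/\gamma_i(F)$ be its pronilpotent completion, and let $p\neq 2$ be a prime. Then $H_2(\hat F,\mathbb Z/p)$ is uncountable. In particular, the integral homology group $H_2(\hat F,\mathbb Z)$ is not divisible.
   Context: $\gamma_i(F)$ denotes the lower central series: $\gamma_1(F)=F$, $\gamma_{i+1}(F)=[\gamma_i(F),F]$. Homology is group homology of $\hat F$ regarded as a discrete group. *)

theory Defs
  imports "HOL-Algebra.Generated_Groups" "HOL-Computational_Algebra.Primes" "HOL-Library.Countable_Set"
begin

definition word_eval :: "('a, 'b) monoid_scheme \<Rightarrow> (bool \<times> 'a) list \<Rightarrow> 'a" where
  "word_eval G w = foldr (\<lambda>(b, x) acc. (if b then x else inv\<^bsub>G\<^esub> x) \<otimes>\<^bsub>G\<^esub> acc) w \<one>\<^bsub>G\<^esub>"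

definition reduced_word :: "(bool \<times> 'a) list \<Rightarrow> bool" where
  "reduced_word w \<longleftrightarrow> (\<forall>i. Suc i < length w \<longrightarrow>
      \<not> (snd (w ! i) = snd (w ! Suc i) \<and> fst (w ! i) \<noteq> fst (w ! Suc i)))"

definition free_basis :: "('a, 'b) monoid_scheme \<Rightarrow> 'a set \<Rightarrow> bool" where
  "free_basis G B \<longleftrightarrow> B \<subseteq> carrier G \<and> generate G B = carrier G \<and>
     (\<forall>w. w \<noteq> [] \<and> set (map snd w) \<subseteq> B \<and> reduced_word w \<longrightarrow> word_eval G w \<noteq> one G)"

definition cyclic_group :: "('a, 'b) monoid_scheme \<Rightarrow> bool" where
  "cyclic_group G \<longleftrightarrow> (\<exists>g \<in> carrier G. generate G {g} = carrier G)"

definition commutator_set :: "('a, 'b) monoid_scheme \<Rightarrow> 'a set \<Rightarrow> 'a set \<Rightarrow> 'a set" where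
  "commutator_set G H K =
     (\<Union>h \<in> H. \<Union>k \<in> K. {h \<otimes>\<^bsub>G\<^esub> k \<otimes>\<^bsub>G\<^esub> inv\<^bsub>G\<^esub> h \<otimes>\<^bsub>G\<^esub> inv\<^bsub>G\<^esub> k})"

text \<open>lcs G n is gamma_(n+1)(G): lcs G 0 = G, lcs G (n+1) = [lcs G n, G].\<close>
fun lcs :: "('a, 'b) monoid_scheme \<Rightarrow> nat \<Rightarrow> 'a set" where
  "lcs G 0 = carrier G"
| "lcs G (Suc n) = generate G (commutator_set G (lcs G n) (carrier G))"

definition pronilpotent_completion :: "('a, 'b) monoid_scheme \<Rightarrow> (nat \<Rightarrow> 'a set) monoid" where
  "pronilpotent_completion G =
     \<lparr> carrier = {s. (\<forall>n. s n \<in> rcosets\<^bsub>G\<^esub> (lcs G n)) \<and> (\<forall>n. s (Suc n) \<subseteq> s n)},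
       monoid.mult = (\<lambda>s t n. s n <#>\<^bsub>G\<^esub> t n),
       one = (\<lambda>n. lcs G n) \<rparr>"

text \<open>Inhomogeneous bar complex C_n(G) = free abelian group on G^n, tensored with Z/m.
  Chains are finitely supported integer-valued functions; Z/m-coefficients are handled by
  working modulo m (for m = 0 this is the integral complex).\<close>

definition chains1 :: "('a, 'b) monoid_scheme \<Rightarrow> ('a \<Rightarrow> int) set" where
  "chains1 G = {c. finite {z. c z \<noteq> 0} \<and> {z. c z \<noteq> 0} \<subseteq> carrier G}"

definition chains2 :: "('a, 'b) monoid_scheme \<Rightarrow> ('a \<times> 'a \<Rightarrow> int) set" where
  "chains2 G = {c. finite {z. c z \<noteq> 0} \<and> {z. c z \<noteq> 0} \<subseteq> carrier G \<times> carrier G}"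

definition chains3 :: "('a, 'b) monoid_scheme \<Rightarrow> ('a \<times> 'a \<times> 'a \<Rightarrow> int) set" where
  "chains3 G = {c. finite {z. c z \<noteq> 0} \<and>
                   {z. c z \<noteq> 0} \<subseteq> carrier G \<times> carrier G \<times> carrier G}"

definition bd2 :: "('a, 'b) monoid_scheme \<Rightarrow> ('a \<times> 'a \<Rightarrow> int) \<Rightarrow> 'a \<Rightarrow> int" where
  "bd2 G c x = (\<Sum>(g, h) \<in> {z. c z \<noteq> 0}. c (g, h) *
      ((if h = x then 1 else 0) - (if g \<otimes>\<^bsub>G\<^esub> h = x then 1 else 0) + (if g = x then 1 else 0)))"

definition bd3 :: "('a, 'b) monoid_scheme \<Rightarrow> ('a \<times> 'a \<times> 'a \<Rightarrow> int) \<Rightarrow> 'a \<times> 'a \<Rightarrow> int" where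
  "bd3 G d y = (\<Sum>(g, h, k) \<in> {z. d z \<noteq> 0}. d (g, h, k) *
      ((if (h, k) = y then 1 else 0) - (if (g \<otimes>\<^bsub>G\<^esub> h, k) = y then 1 else 0)
       + (if (g, h \<otimes>\<^bsub>G\<^esub> k) = y then 1 else 0) - (if (g, h) = y then 1 else 0)))"

definition cycles2 :: "int \<Rightarrow> ('a, 'b) monoid_scheme \<Rightarrow> ('a \<times> 'a \<Rightarrow> int) set" where
  "cycles2 m G = {c \<in> chains2 G. \<forall>x. m dvd bd2 G c x}"

definition homologous2 :: "int \<Rightarrow> ('a, 'b) monoid_scheme \<Rightarrow> ('a \<times> 'a \<Rightarrow> int) \<Rightarrow> ('a \<times> 'a \<Rightarrow> int) \<Rightarrow> bool" where
  "homologous2 m G c c' \<longleftrightarrow> (\<exists>d \<in> chains3 G. \<forall>y. m dvd (c y - c' y - bd3 G d y))"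

definition H2 :: "int \<Rightarrow> ('a, 'b) monoid_scheme \<Rightarrow> ('a \<times> 'a \<Rightarrow> int) set set" where
  "H2 m G = cycles2 m G // {(c, c'). c \<in> cycles2 m G \<and> c' \<in> cycles2 m G \<and> homologous2 m G c c'}"

definition H2_Z_divisible :: "('a, 'b) monoid_scheme \<Rightarrow> bool" where
  "H2_Z_divisible G \<longleftrightarrow> (\<forall>n::int. n \<ge> 1 \<longrightarrow>
     (\<forall>c \<in> cycles2 0 G. \<exists>d \<in> cycles2 0 G. homologous2 0 G c (\<lambda>y. n * d y)))"

end

theory Submission
  imports Defs "HOL-Computational_Algebra.Formal_Laurent_Series"
begin

text \<open>
  Let \<open>a \<noteq> b\<close> be two elements of the basis, and let \<open>Z\<close> act on \<open>A = Z[[X]]\<close> through the unit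
  \<open>t = 1 + X\<close> or through \<open>t\<^sup>-\<^sup>1\<close>. Sending \<open>a\<close> to the generator of \<open>Z\<close>, \<open>b\<close> to \<open>1 \<in> A\<close> and the rest of
  the basis to the identity gives homomorphisms \<open>F \<rightarrow> Z \<ltimes> A\<close>, which extend to the completion since
  \<open>\<gamma>\<^sub>n\<^sub>+\<^sub>1\<close> goes to \<open>X\<^sup>n A\<close>.

  If \<open>r, s\<close> lie in the second term of the completed lower central series of \<open>\<langle>a, b\<rangle>\<close>, then successive
  approximation yields \<open>u, v\<close> in that term with \<open>[r, s] = [a, u] [b, v]\<close>. This relation defines an
  integral 2-cycle. In \<open>Z \<ltimes> A\<close> the element \<open>u\<close> becomes trivial, because \<open>X\<close> is a nonzerodivisor,
  and only \<open>v\<close> stays uncontrolled; so the cycle represents \<open>r \<and> s - 1 \<and> v\<close>.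

  Let \<open>K\<close> be a countable subfield of the Laurent series modulo \<open>p\<close> that contains \<open>t\<close>, and let \<open>\<phi>, \<psi>\<close>
  be \<open>K\<close>-linear endomorphisms (modulo \<open>p\<close>) of the Laurent series with \<open>\<phi> 1 = \<psi> 1 = 0\<close>. They give an
  invariant bilinear form, hence a 2-cocycle, which sends the cycle to
  \<open>\<phi> r * \<psi> s' - \<phi> s * \<psi> r'\<close>; here \<open>r, s\<close> stand for the images under the action through \<open>t\<close>, and
  \<open>r', s'\<close> for those through \<open>t\<^sup>-\<^sup>1\<close>. Fix \<open>s\<close> with \<open>s, s' \<notin> K\<close>. There are uncountably many \<open>r\<close>
  but \<open>K + K s\<close> is countable, so among countably many homology classes two would agree for some
  \<open>r\<^sub>1, r\<^sub>2\<close> with \<open>r\<^sub>1 - r\<^sub>2 \<notin> K + K s\<close>. A choice of \<open>\<phi>\<close> with \<open>\<phi> s = 0\<close>, \<open>\<phi> (r\<^sub>1 - r\<^sub>2) = 1\<close> and of \<open>\<psi>\<close>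
  with \<open>\<psi> s' = 1\<close> separates them. The cycles being integral, the same cocycle
  shows that one of them is not divisible by \<open>p\<close>.
\<close>

section \<open>Linear maps over subfields modulo a prime\<close>

text \<open>\<open>K\<close> represents a subring of the quotient by \<open>q\<close> in which every
  nonzero element is invertible. Representatives and divisibility replace the quotient ring; the
  instance of interest is a field of Laurent series modulo a prime, represented inside
  \<open>int fls\<close>.\<close>

locale subfield_modulo =
  fixes q :: "'r::comm_ring_1" and K :: "'r set"
  assumes one_mem: "1 \<in> K"
    and diff_mem: "\<And>a b. a \<in> K \<Longrightarrow> b \<in> K \<Longrightarrow> a - b \<in> K"
    and mult_mem: "\<And>a b. a \<in> K \<Longrightarrow> b \<in> K \<Longrightarrow> a * b \<in> K"
    and inverse_mem: "\<And>a. a \<in> K \<Longrightarrow> \<not> q dvd a \<Longrightarrow> \<exists>b \<in> K. q dvd a * b - 1"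
begin

lemma zero_mem: "0 \<in> K"
  using diff_mem[OF one_mem one_mem] by simp

lemma uminus_mem: "a \<in> K \<Longrightarrow> - a \<in> K"
  using diff_mem[OF zero_mem, of a] by simp

lemma add_mem: "a \<in> K \<Longrightarrow> b \<in> K \<Longrightarrow> a + b \<in> K"
  using diff_mem[of a "- b"] uminus_mem by simp

text \<open>
  Graphs of partially defined maps that are \<open>K\<close>-linear modulo \<open>q\<close>; the last clause says that such a
  map is well defined modulo \<open>q\<close>.
\<close>

definition linear_graph :: "('r \<times> 'r) set \<Rightarrow> bool" where
  "linear_graph W \<longleftrightarrow>
     (\<forall>a b a' b'. (a, b) \<in> W \<longrightarrow> (a', b') \<in> W \<longrightarrow> (a + a', b + b') \<in> W) \<and>
     (\<forall>k a b. k \<in> K \<longrightarrow> (a, b) \<in> W \<longrightarrow> (k * a, k * b) \<in> W) \<and>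
     (\<forall>a b. q dvd a \<longrightarrow> q dvd b \<longrightarrow> (a, b) \<in> W) \<and>
     (\<forall>a b. (a, b) \<in> W \<longrightarrow> q dvd a \<longrightarrow> q dvd b)"

lemma linear_graph_add: "linear_graph W \<Longrightarrow> (a, b) \<in> W \<Longrightarrow> (a', b') \<in> W \<Longrightarrow> (a + a', b + b') \<in> W"
  and linear_graph_scale: "linear_graph W \<Longrightarrow> k \<in> K \<Longrightarrow> (a, b) \<in> W \<Longrightarrow> (k * a, k * b) \<in> W"
  and linear_graph_zero: "linear_graph W \<Longrightarrow> q dvd a \<Longrightarrow> q dvd b \<Longrightarrow> (a, b) \<in> W"
  and linear_graph_single: "linear_graph W \<Longrightarrow> (a, b) \<in> W \<Longrightarrow> q dvd a \<Longrightarrow> q dvd b"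
  unfolding linear_graph_def by metis+

lemma linear_graph_diff:
  assumes "linear_graph W" "(a, b) \<in> W" "(a', b') \<in> W"
  shows "(a - a', b - b') \<in> W"
  using linear_graph_add[OF assms(1,2) linear_graph_scale[OF assms(1) uminus_mem[OF one_mem] assms(3)]]
  by simp

text \<open>The new element \<open>c\<close> is adjoined with value 0. This is consistent: if
  \<open>x + k * c\<close> vanished modulo \<open>q\<close> with \<open>k\<close> invertible, then
  \<open>c\<close> would be congruent to a \<open>K\<close>-multiple of \<open>x\<close> and would
  already lie in the domain, which is closed under congruence modulo \<open>q\<close>.\<close>

lemma linear_graph_extend:
  assumes W: "linear_graph W" and c: "c \<notin> Domain W"
  shows "\<exists>W'. linear_graph W' \<and> W \<subseteq> W' \<and> c \<in> Domain W'"
proof (intro exI conjI)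
  define V where "V = {(x + k * c, y) |x y k. (x, y) \<in> W \<and> k \<in> K}"
  have V_iff: "(a, b) \<in> V \<longleftrightarrow> (\<exists>x k. (x, b) \<in> W \<and> k \<in> K \<and> a = x + k * c)" for a b
    by (auto simp: V_def)
  have single: "q dvd b" if V: "(a, b) \<in> V" and "q dvd a" for a b
  proof -
    obtain x k where xk: "(x, b) \<in> W" "k \<in> K" "a = x + k * c" using V unfolding V_iff by blast
    have "q dvd k"
    proof (rule ccontr)
      assume "\<not> q dvd k"
      then obtain l where l: "l \<in> K" "q dvd k * l - 1" using inverse_mem xk by blast
      have "(- l * x, - l * b) \<in> W" using linear_graph_scale[OF W uminus_mem[OF l(1)] xk(1)] .
      moreover have "q dvd c + l * x"
      proof -
        have "c + l * x = l * a - (k * l - 1) * c" using xk by (simp add: algebra_simps)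
        then show ?thesis using l that xk by (metis dvd_diff dvd_mult dvd_mult2)
      qed
      then have "(c + l * x, 0) \<in> W" by (rule linear_graph_zero[OF W]) simp
      ultimately have "(c + l * x + - l * x, 0 + - l * b) \<in> W" by (rule linear_graph_add[OF W, rotated])
      then show False using c by (auto simp: Domain_iff)
    qed
    then have "q dvd x" using that xk by (metis dvd_add_left_iff dvd_mult2)
    then show ?thesis using linear_graph_single[OF W xk(1)] by simp
  qed
  have add: "(a + a', b + b') \<in> V" if V: "(a, b) \<in> V" "(a', b') \<in> V" for a b a' b'
  proof -
    obtain x k x' k' where "(x, b) \<in> W" "k \<in> K" "a = x + k * c" "(x', b') \<in> W" "k' \<in> K" "a' = x' + k' * c"
      using V unfolding V_iff by blast
    then show ?thesis using linear_graph_add[OF W, of x b x' b'] add_mem[of k k'] unfolding V_iff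
      by (intro exI[of _ "x + x'"] exI[of _ "k + k'"]) (simp add: algebra_simps)
  qed
  have scale: "(l * a, l * b) \<in> V" if l: "l \<in> K" and V: "(a, b) \<in> V" for a b l
  proof -
    obtain x k where "(x, b) \<in> W" "k \<in> K" "a = x + k * c"
      using V unfolding V_iff by blast
    then show ?thesis using linear_graph_scale[OF W l, of x b] mult_mem[OF l, of k] unfolding V_iff
      by (intro exI[of _ "l * x"] exI[of _ "l * k"]) (simp add: algebra_simps)
  qed
  show sub: "W \<subseteq> V"
  proof
    fix w assume "w \<in> W"
    then have "(fst w, snd w) \<in> V" unfolding V_iff
      using zero_mem by (intro exI[of _ "fst w"] exI[of _ 0]) simp
    then show "w \<in> V" by simp
  qed
  then show "linear_graph V" unfolding linear_graph_def
    using linear_graph_zero[OF W] add scale single by blast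
  have "(0, 0) \<in> W" by (rule linear_graph_zero[OF W]) auto
  then have "(c, 0) \<in> V" unfolding V_iff using one_mem by (intro exI[of _ 0] exI[of _ 1]) simp
  then show "c \<in> Domain V" by blast
qed

text \<open>The chain condition brings two pairs into a common member, which gives additivity; the
  other closure properties concern one member at a time.\<close>

lemma linear_graph_Union:
  assumes "C \<noteq> {}" and lin: "\<And>W. W \<in> C \<Longrightarrow> linear_graph W"
    and chain: "\<And>W W'. W \<in> C \<Longrightarrow> W' \<in> C \<Longrightarrow> W \<subseteq> W' \<or> W' \<subseteq> W"
  shows "linear_graph (\<Union>C)"
  unfolding linear_graph_def
proof (intro conjI allI impI)
  fix a b a' b' assume "(a, b) \<in> \<Union>C" "(a', b') \<in> \<Union>C"
  then obtain W W' where "W \<in> C" "W' \<in> C" "(a, b) \<in> W" "(a', b') \<in> W'" by blast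
  then obtain V where "V \<in> C" "(a, b) \<in> V" "(a', b') \<in> V" using chain by blast
  then show "(a + a', b + b') \<in> \<Union>C" using linear_graph_add[OF lin] by blast
qed (use assms(1) linear_graph_scale[OF lin] linear_graph_zero[OF lin] linear_graph_single[OF lin]
     in blast)+

text \<open>By Zorn's lemma there is a maximal graph, and an element missing from its domain would
  give a proper extension.\<close>

lemma linear_graph_total:
  assumes "linear_graph W"
  shows "\<exists>M. linear_graph M \<and> W \<subseteq> M \<and> Domain M = UNIV"
proof -
  let ?A = "{M. linear_graph M \<and> W \<subseteq> M}"
  have "\<exists>M\<in>?A. \<forall>X\<in>?A. M \<subseteq> X \<longrightarrow> X = M"
  proof (rule subset_Zorn_nonempty)
    fix C assume C: "C \<noteq> {}" "subset.chain ?A C"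
    have "linear_graph (\<Union>C)"
      by (rule linear_graph_Union) (use C in \<open>auto simp: subset_chain_def\<close>)
    moreover have "W \<subseteq> \<Union>C" using C unfolding subset_chain_def by blast
    ultimately show "\<Union>C \<in> ?A" by blast
  qed (use assms in auto)
  then obtain M where M': "M \<in> ?A" and max': "\<forall>X\<in>?A. M \<subseteq> X \<longrightarrow> X = M" by (rule bexE)
  from M' have M: "linear_graph M" "W \<subseteq> M" by simp_all
  have max: "X = M" if "linear_graph X" "W \<subseteq> X" "M \<subseteq> X" for X
    using max' that by simp
  have "c \<in> Domain M" for c
  proof (rule ccontr)
    assume "c \<notin> Domain M"
    from linear_graph_extend[OF M(1) this] obtain X where "linear_graph X" "M \<subseteq> X" "c \<in> Domain X" by blast
    with max[of X] M(2) \<open>c \<notin> Domain M\<close> show False by auto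
  qed
  with M show ?thesis by blast
qed

text \<open>The laws hold only up to multiples of \<open>q\<close>, since values are chosen
  representatives of classes modulo \<open>q\<close>.\<close>

definition linear_modulo :: "('r \<Rightarrow> 'r) \<Rightarrow> bool" where
  "linear_modulo \<phi> \<longleftrightarrow> (\<forall>a b. q dvd \<phi> (a + b) - (\<phi> a + \<phi> b)) \<and>
     (\<forall>k \<in> K. \<forall>a. q dvd \<phi> (k * a) - k * \<phi> a)"

text \<open>The map extends the functional "coefficient of \<open>d\<close>" from the span of 1,
  \<open>s\<close> and \<open>d\<close>. That coefficient is well defined modulo \<open>q\<close>
  because \<open>d\<close> is not congruent to an element of \<open>K + K s\<close>. The elements 1
  and \<open>s\<close> may be dependent, so \<open>s = 0\<close> is allowed.\<close>

lemma exists_linear_modulo: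
  assumes indep: "\<And>k l. k \<in> K \<Longrightarrow> l \<in> K \<Longrightarrow> \<not> q dvd d - (k + l * s)"
  shows "\<exists>\<phi>. linear_modulo \<phi> \<and> q dvd \<phi> 1 \<and> q dvd \<phi> s \<and> q dvd \<phi> d - 1"
proof -
  let ?P = "\<lambda>a b k l m. k \<in> K \<and> l \<in> K \<and> m \<in> K \<and> q dvd a - (k + l * s + m * d) \<and> q dvd b - m"
  define V where "V = {(a, b). \<exists>k l m. ?P a b k l m}"
  have V_iff: "(a, b) \<in> V \<longleftrightarrow> (\<exists>k l m. ?P a b k l m)" for a b by (simp add: V_def)
  have add: "(a + a', b + b') \<in> V" if W: "(a, b) \<in> V" "(a', b') \<in> V" for a b a' b'
  proof -
    obtain k l m k' l' m' where "?P a b k l m" "?P a' b' k' l' m'" using W unfolding V_iff by blast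
    moreover from this have "q dvd (a - (k + l * s + m * d)) + (a' - (k' + l' * s + m' * d))"
       "q dvd (b - m) + (b' - m')" by (auto intro: dvd_add)
    ultimately have "?P (a + a') (b + b') (k + k') (l + l') (m + m')"
      by (auto simp: add_mem algebra_simps)
    then show ?thesis unfolding V_iff by blast
  qed
  have scale: "(x * a, x * b) \<in> V" if W: "x \<in> K" "(a, b) \<in> V" for a b x
  proof -
    obtain k l m where "?P a b k l m" using W unfolding V_iff by blast
    moreover from this have "q dvd x * (a - (k + l * s + m * d))" "q dvd x * (b - m)" by (auto)
    ultimately have "?P (x * a) (x * b) (x * k) (x * l) (x * m)"
      using W by (auto simp: mult_mem algebra_simps)
    then show ?thesis unfolding V_iff by blast
  qed
  have single: "q dvd b" if W: "(a, b) \<in> V" "q dvd a" for a b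
  proof -
    obtain k l m where P: "?P a b k l m" using W unfolding V_iff by blast
    have "q dvd m"
    proof (rule ccontr)
      assume "\<not> q dvd m"
      then obtain n where n: "n \<in> K" "q dvd m * n - 1" using inverse_mem P by blast
      \<comment> \<open>If the coefficient \<open>m\<close> had an inverse \<open>n\<close>,
        multiplying the relation by \<open>n\<close> would solve it for \<open>d\<close>.\<close>
      have "d - ((- n * k) + (- n * l) * s) = n * a - n * (a - (k + l * s + m * d)) - (m * n - 1) * d"
        by (simp add: algebra_simps)
      also have "q dvd \<dots>"
        using dvd_mult[OF W(2), of n] dvd_mult[of q "a - (k + l * s + m * d)" n] dvd_mult2[OF n(2), of d] P
        by (blast intro: dvd_diff)
      finally show False using indep[of "- n * k" "- n * l"] n P by (auto simp: mult_mem uminus_mem)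
    qed
    then show ?thesis using P by (metis dvd_diff_left_iff)
  qed
  have zero: "(a, b) \<in> V" if "q dvd a" "q dvd b" for a b
  proof -
    have "?P a b 0 0 0" using that zero_mem by auto
    then show ?thesis unfolding V_iff by blast
  qed
  have "linear_graph V" unfolding linear_graph_def using add scale zero single by blast
  then obtain M where M: "linear_graph M" "V \<subseteq> M" "Domain M = UNIV" using linear_graph_total by blast
  define \<phi> where "\<phi> a = (SOME b. (a, b) \<in> M)" for a
  have \<phi>: "(a, \<phi> a) \<in> M" for a unfolding \<phi>_def using M(3) by (metis Domain_iff UNIV_I someI_ex)
  \<comment> \<open>Two values at the same element differ by a value at 0, hence by a multiple of
    \<open>q\<close>.\<close>
  have unique: "q dvd \<phi> a - b" if "(a, b) \<in> M" for a b
    using linear_graph_single[OF M(1) linear_graph_diff[OF M(1) \<phi> that]] by simp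
  have "linear_modulo \<phi>" unfolding linear_modulo_def
    by (auto intro!: unique linear_graph_add[OF M(1)] linear_graph_scale[OF M(1)] \<phi>)
  moreover have "?P 1 0 1 0 0" "?P s 0 0 1 0" "?P d 1 0 0 1" using zero_mem one_mem by auto
  then have "(1, 0) \<in> V" "(s, 0) \<in> V" "(d, 1) \<in> V" unfolding V_iff by blast+
  then have "(1, 0) \<in> M" "(s, 0) \<in> M" "(d, 1) \<in> M" using M(2) by blast+
  then have "q dvd \<phi> 1 - 0" "q dvd \<phi> s - 0" "q dvd \<phi> d - 1" by (blast intro: unique)+
  ultimately show ?thesis by auto
qed

end

text \<open>Closing \<open>insert 1 X\<close> in countably many rounds under differences, products
  and one chosen inverse per element keeps it countable.\<close>

lemma exists_countable_subfield_modulo: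
  fixes q :: "'r::comm_ring_1"
  assumes inverse: "\<And>a. \<not> q dvd a \<Longrightarrow> \<exists>b. q dvd a * b - 1" and X: "countable X"
  shows "\<exists>K. countable K \<and> X \<subseteq> K \<and> subfield_modulo q K"
proof -
  \<comment> \<open>When \<open>a\<close> has no inverse modulo \<open>q\<close>, the choice in the
    last part is an arbitrary element; including it does no harm.\<close>
  define st where "st K = K \<union> (\<lambda>(a, b). a - b) ` (K \<times> K) \<union> (\<lambda>(a, b). a * b) ` (K \<times> K) \<union>
    (\<lambda>a. SOME b. q dvd a * b - 1) ` K" for K :: "'r set"
  define L where "L n = (st ^^ n) (insert 1 X)" for n :: nat
  have cL: "countable (L n)" for n
    by (induction n) (use X in \<open>auto simp: L_def st_def\<close>)
  have Suc: "L (Suc n) = st (L n)" for n by (simp add: L_def)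
  have "L n \<subseteq> L (Suc n)" for n unfolding Suc by (auto simp: st_def)
  then have mono: "n \<le> m \<Longrightarrow> L n \<subseteq> L m" for n m by (rule lift_Suc_mono_le)
  have step: "\<exists>n. a \<in> L n \<and> b \<in> L n" if ab: "a \<in> (\<Union>n. L n)" "b \<in> (\<Union>n. L n)" for a b
  proof -
    obtain n m where "a \<in> L n" "b \<in> L m" using ab by blast
    then have "a \<in> L (max n m)" "b \<in> L (max n m)" using mono[of n "max n m"] mono[of m "max n m"] by auto
    then show ?thesis by blast
  qed
  have st: "a - b \<in> L (Suc n)" "a * b \<in> L (Suc n)" "(SOME b. q dvd a * b - 1) \<in> L (Suc n)"
    if "a \<in> L n" "b \<in> L n" for a b n
  proof -
    have "(a, b) \<in> L n \<times> L n" using that by simp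
    then show "a - b \<in> L (Suc n)" "a * b \<in> L (Suc n)" "(SOME b. q dvd a * b - 1) \<in> L (Suc n)"
      unfolding Suc st_def by (blast intro: rev_image_eqI)+
  qed
  have "subfield_modulo q (\<Union>n. L n)"
  proof
    show "1 \<in> (\<Union>n. L n)" by (auto simp: L_def intro!: exI[of _ 0])
    fix a b assume a: "a \<in> (\<Union>n. L n)" and b: "b \<in> (\<Union>n. L n)"
    obtain n where "a \<in> L n" "b \<in> L n" using step[OF a b] by blast
    then have "a - b \<in> L (Suc n)" "a * b \<in> L (Suc n)" by (rule st)+
    then show "a - b \<in> (\<Union>n. L n)" "a * b \<in> (\<Union>n. L n)" by blast+
  next
    fix a assume a: "a \<in> (\<Union>n. L n)" and q: "\<not> q dvd a"
    obtain n where "a \<in> L n" using a by blast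
    then have "(SOME b. q dvd a * b - 1) \<in> L (Suc n)" using st(3)[of a n a] by blast
    moreover have "q dvd a * (SOME b. q dvd a * b - 1) - 1" by (rule someI_ex[OF inverse[OF q]])
    ultimately show "\<exists>b \<in> (\<Union>n. L n). q dvd a * b - 1" by blast
  qed
  moreover have "X \<subseteq> L 0" by (auto simp: L_def)
  ultimately show ?thesis using cL by (intro exI[of _ "\<Union>n. L n"]) auto
qed

section \<open>Integral power series and Laurent series modulo a prime\<close>

lemma of_int_eq_fps_const: "(of_int m :: int fps) = fps_const m"
  by (metis fps_of_int of_int_eq_id id_apply)

lemma of_int_eq_fls_const: "(of_int m :: int fls) = fls_const m"
  by (metis fls_of_int of_int_eq_id id_apply)

lemma of_int_dvd_fps_iff: "(of_int m :: int fps) dvd a \<longleftrightarrow> (\<forall>n. m dvd fps_nth a n)"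
proof
  assume "of_int m dvd a"
  then obtain b where "a = of_int m * b" ..
  then show "\<forall>n. m dvd fps_nth a n" unfolding of_int_eq_fps_const by simp
next
  assume *: "\<forall>n. m dvd fps_nth a n"
  have "a = of_int m * Abs_fps (\<lambda>n. fps_nth a n div m)"
    unfolding of_int_eq_fps_const by (rule fps_ext) (use * in simp)
  then show "of_int m dvd a" by (rule dvdI)
qed

lemma of_int_dvd_fls_nth:
  assumes "(of_int m :: int fls) dvd a"
  shows "m dvd fls_nth a n"
proof -
  obtain b where "a = of_int m * b" using assms ..
  then show ?thesis unfolding of_int_eq_fls_const by simp
qed

lemma of_int_dvd_fps_to_fls_iff: "(of_int m :: int fls) dvd fps_to_fls a \<longleftrightarrow> of_int m dvd a"
proof
  assume *: "of_int m dvd fps_to_fls a"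
  have "m dvd fps_nth a n" for n
    using of_int_dvd_fls_nth[OF *, of "int n"] by simp
  then show "of_int m dvd a" unfolding of_int_dvd_fps_iff by blast
next
  assume "of_int m dvd a"
  then obtain b where "a = of_int m * b" ..
  then have "fps_to_fls a = of_int m * fps_to_fls b"
    by (simp only: fls_times_fps_to_fls fps_to_fls_of_int)
  then show "of_int m dvd fps_to_fls a" by (rule dvdI)
qed

text \<open>Modulo \<open>p\<close> the series is \<open>fps_X ^ n\<close> times a series whose
  constant term is invertible modulo \<open>p\<close>, so it divides a power of \<open>fps_X\<close>
  modulo \<open>p\<close>.\<close>

lemma inverse_modulo_prime_fps:
  fixes a :: "int fps"
  assumes p: "prime p" and a: "\<not> of_nat p dvd a"
  shows "\<exists>b n. of_nat p dvd a * b - fps_X ^ n"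
proof -
  define n where "n = (LEAST n. \<not> int p dvd fps_nth a n)"
  have ex: "\<exists>n. \<not> int p dvd fps_nth a n" using a of_int_dvd_fps_iff[of "int p" a] by simp
  have n: "\<not> int p dvd fps_nth a n" and least: "\<And>i. i < n \<Longrightarrow> int p dvd fps_nth a i"
    using LeastI_ex[OF ex] not_less_Least unfolding n_def by auto
  have "coprime (fps_nth a n) (int p)"
    using n p by (simp add: coprime_commute prime_imp_coprime)
  then obtain c v where "c * fps_nth a n + v * int p = 1"
    by (metis bezout_int coprime_imp_gcd_eq_1)
  then have m: "fps_nth a n * c = 1 + int p * (- v)" by (simp add: algebra_simps)
  define m where "m = - v"
  note m = m[folded m_def]
  \<comment> \<open>By the Bezout relation \<open>c\<close> times the shifted series has constant
    term \<open>1 + p * m\<close>. Subtracting \<open>p * m\<close> makes it exactly 1, so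
    \<open>g\<close> is invertible over the integers.\<close>
  define g where "g = fps_const c * fps_shift n a - fps_const (int p * m)"
  have "fps_nth g 0 = 1" unfolding g_def using m by (simp add: mult.commute)
  then have "g * fps_right_inverse g 1 = 1" by (intro fps_right_inverse) simp
  then obtain h where h: "g * h = 1" by blast
  \<comment> \<open>The part of \<open>a\<close> below degree \<open>n\<close>, divisible by
    \<open>p\<close> because \<open>n\<close> is minimal.\<close>
  define r where "r = a - fps_shift n a * fps_X ^ n"
  have r: "of_nat p dvd r"
  proof -
    have "int p dvd fps_nth r i" for i
      using least[of i] by (cases "i < n") (auto simp: r_def fps_X_power_mult_right_nth)
    then show ?thesis using of_int_dvd_fps_iff[of "int p" r] by simp
  qed
  have "a * (fps_const c * h) - fps_X ^ n =
      r * (fps_const c * h) + (fps_const c * fps_shift n a) * h * fps_X ^ n - fps_X ^ n"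
    by (simp add: r_def algebra_simps)
  also have "(fps_const c * fps_shift n a) * h = 1 + fps_const (int p * m) * h"
    using h by (simp add: g_def algebra_simps)
  also have "fps_const (int p * m) = of_nat p * fps_const m"
    using of_int_eq_fps_const[of "int p"] by (simp only: of_int_of_nat_eq fps_const_mult)
  also have "r * (fps_const c * h) + (1 + of_nat p * fps_const m * h) * fps_X ^ n - fps_X ^ n
     = r * (fps_const c * h) + of_nat p * (fps_const m * h * fps_X ^ n)"
    by (simp add: algebra_simps)
  also have "of_nat p dvd \<dots>" using r by (intro dvd_add) auto
  finally show ?thesis by blast
qed

text \<open>Factoring out a power of \<open>X\<close> leaves a power series that is invertible
  modulo \<open>p\<close> up to another power of \<open>X\<close>, and powers of \<open>X\<close>
  are units among Laurent series.\<close>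

lemma inverse_modulo_prime_fls:
  fixes a :: "int fls"
  assumes p: "prime p" and a: "\<not> of_nat p dvd a"
  shows "\<exists>b. of_nat p dvd a * b - 1"
proof -
  define d where "d = fls_subdegree a"
  define g where "g = fls_base_factor_to_fps a"
  have ag: "a = fls_X_intpow d * fps_to_fls g"
    unfolding g_def d_def fps_to_fls_base_factor_to_fps by (simp add: fls_X_intpow_times_conv_shift)
  have "\<not> of_nat p dvd g"
    using a ag of_int_dvd_fps_to_fls_iff[of "int p" g] by auto
  then obtain b n where "of_nat p dvd g * b - fps_X ^ n"
    using inverse_modulo_prime_fps[OF p] by blast
  then have "of_nat p dvd fps_to_fls (g * b - fps_X ^ n)"
    using of_int_dvd_fps_to_fls_iff[of "int p" "g * b - fps_X ^ n"] by (simp del: fps_to_fls_minus)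
  then have *: "of_nat p dvd fps_to_fls g * fps_to_fls b - fls_X_intpow (int n)"
    by (simp add: fls_times_fps_to_fls fps_to_fls_power fls_X_power_conv_shift_1)
  let ?b = "fls_X_intpow (- d) * fls_X_intpow (- int n) * fps_to_fls b"
  have inv: "fls_X_intpow d * fls_X_intpow (- d) = (1 :: int fls)" for d
    unfolding fls_X_intpow_times_fls_X_intpow by simp
  have "a * ?b - 1 = (fls_X_intpow d * fls_X_intpow (- d)) * fls_X_intpow (- int n) * (fps_to_fls g * fps_to_fls b) - 1"
    unfolding ag by (simp only: mult_ac)
  also have "\<dots> = fls_X_intpow (- int n) * (fps_to_fls g * fps_to_fls b - fls_X_intpow (int n))"
    unfolding inv right_diff_distrib using inv[of "- int n"] by (simp only: minus_minus mult_1)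
  finally show ?thesis using * by (metis dvd_mult)
qed

section \<open>Free groups and lower central series\<close>

lemma word_eval_Nil: "word_eval G [] = \<one>\<^bsub>G\<^esub>"
  and word_eval_Cons: "word_eval G ((b, x) # w) = (if b then x else inv\<^bsub>G\<^esub> x) \<otimes>\<^bsub>G\<^esub> word_eval G w"
  by (simp_all add: word_eval_def)

lemma not_reduced_wordE:
  assumes "\<not> reduced_word w"
  obtains u v b x where "w = u @ (b, x) # (\<not> b, x) # v"
proof -
  obtain i where i: "Suc i < length w" "snd (w ! i) = snd (w ! Suc i)" "fst (w ! i) \<noteq> fst (w ! Suc i)"
    using assms unfolding reduced_word_def by blast
  have "w = take i w @ w ! i # w ! Suc i # drop (Suc (Suc i)) w"
    using i(1) by (metis Cons_nth_drop_Suc Suc_lessD append_take_drop_id)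
  moreover have "w ! i = (fst (w ! i), snd (w ! i))" "w ! Suc i = (\<not> fst (w ! i), snd (w ! i))"
    using i by (auto simp: prod_eq_iff)
  ultimately show ?thesis using that by metis
qed

lemma snd_set_map_apsnd: "snd ` set (map (apsnd h) w) = h ` snd ` set w"
  by (simp add: image_image)

lemma snd_set_map_apfst: "snd ` set (map (apfst h) w) = snd ` set w"
  by (simp add: image_image)

context group
begin

lemma l_cancel_inv: "x \<in> carrier G \<Longrightarrow> y \<in> carrier G \<Longrightarrow> x \<otimes> (inv x \<otimes> y) = y"
  and l_cancel_inv': "x \<in> carrier G \<Longrightarrow> y \<in> carrier G \<Longrightarrow> inv x \<otimes> (x \<otimes> y) = y"
  by (simp_all add: m_assoc[symmetric])

lemma word_eval_closed: "snd ` set w \<subseteq> carrier G \<Longrightarrow> word_eval G w \<in> carrier G"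
  by (induction w) (auto simp: word_eval_Nil word_eval_Cons)

lemma word_eval_append:
  "snd ` set v \<subseteq> carrier G \<Longrightarrow> snd ` set w \<subseteq> carrier G \<Longrightarrow>
    word_eval G (v @ w) = word_eval G v \<otimes> word_eval G w"
  by (induction v) (auto simp: word_eval_Nil word_eval_Cons word_eval_closed m_assoc)

lemma word_eval_cancel:
  assumes "snd ` set u \<subseteq> carrier G" "snd ` set v \<subseteq> carrier G" "x \<in> carrier G"
  shows "word_eval G (u @ (b, x) # (\<not> b, x) # v) = word_eval G (u @ v)"
  using assms by (simp add: word_eval_append word_eval_Cons word_eval_closed l_cancel_inv l_cancel_inv')

lemma word_eval_inverse:
  "snd ` set w \<subseteq> carrier G \<Longrightarrow> word_eval G (rev (map (apfst Not) w)) = inv (word_eval G w)"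
proof (induction w)
  case (Cons c w)
  obtain b x where c: "c = (b, x)" by fastforce
  with Cons.prems have x: "x \<in> carrier G" and w: "snd ` set w \<subseteq> carrier G" by auto
  then have "snd ` set (rev (map (apfst Not) w)) \<subseteq> carrier G" by auto
  then show ?case using Cons.IH[OF w] x w word_eval_closed[OF w]
    by (simp add: c word_eval_append word_eval_Cons word_eval_Nil inv_mult_group)
qed (simp add: word_eval_Nil)

lemma generate_word_eval:
  assumes "B \<subseteq> carrier G" and "g \<in> generate G B"
  shows "\<exists>w. snd ` set w \<subseteq> B \<and> word_eval G w = g"
  using assms(2)
proof (induction rule: generate.induct)
  case one
  then show ?case by (intro exI[of _ "[]"]) (simp add: word_eval_Nil)
next
  case (incl h)
  then show ?case using assms(1)
    by (intro exI[of _ "[(True, h)]"]) (auto simp add: word_eval_Nil word_eval_Cons)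
next
  case (inv h)
  then show ?case using assms(1)
    by (intro exI[of _ "[(False, h)]"]) (auto simp add: word_eval_Nil word_eval_Cons)
next
  case (eng h k)
  then obtain v w where "snd ` set v \<subseteq> B" "word_eval G v = h" "snd ` set w \<subseteq> B" "word_eval G w = k"
    by blast
  then show ?case using assms(1)
    by (intro exI[of _ "v @ w"]) (auto simp add: word_eval_append image_Un)
qed

end

text \<open>A nonempty word with trivial value is not reduced, and deleting a cancelling pair
  changes neither its value in \<open>G\<close> nor that of its image in \<open>Q\<close>. Induction
  on the length finishes the argument.\<close>

lemma free_basis_word_eval_one:
  assumes "group G" and "group Q" and B: "free_basis G B" and h: "h \<in> B \<rightarrow> carrier Q"
    and "snd ` set w \<subseteq> B" and "word_eval G w = \<one>\<^bsub>G\<^esub>"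
  shows "word_eval Q (map (apsnd h) w) = \<one>\<^bsub>Q\<^esub>"
  using assms(5,6)
proof (induction w rule: length_induct)
  case (1 w)
  interpret G: group G by fact
  interpret Q: group Q by fact
  have BG: "B \<subseteq> carrier G" using B by (simp add: free_basis_def)
  show ?case
  proof (cases "w = []")
    case True
    then show ?thesis by (simp add: word_eval_Nil)
  next
    case False
    then have "\<not> reduced_word w"
      using B 1(2,3) unfolding free_basis_def by auto
    then obtain u v b x where w: "w = u @ (b, x) # (\<not> b, x) # v" by (rule not_reduced_wordE)
    have uv: "snd ` set u \<subseteq> B" "snd ` set v \<subseteq> B" "x \<in> B" using 1(2) by (auto simp: w)
    then have "word_eval G (u @ v) = \<one>\<^bsub>G\<^esub>"
      using 1(3) G.word_eval_cancel[OF order_trans[OF uv(1) BG] order_trans[OF uv(2) BG] subsetD[OF BG uv(3)], of b]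
      by (simp add: w)
    then have "word_eval Q (map (apsnd h) (u @ v)) = \<one>\<^bsub>Q\<^esub>"
      using 1(1)[rule_format, of "u @ v"] uv by (simp add: w image_Un)
    moreover have "snd ` set (map (apsnd h) u) \<subseteq> carrier Q" "snd ` set (map (apsnd h) v) \<subseteq> carrier Q"
       "h x \<in> carrier Q"
      unfolding snd_set_map_apsnd using uv h by blast+
    ultimately show ?thesis
      using Q.word_eval_cancel[of "map (apsnd h) u" "map (apsnd h) v" "h x" b] by (simp add: w)
  qed
qed

text \<open>The image of an element is the value of any word representing it. Independence of the
  word follows from \<open>free_basis_word_eval_one\<close>, applied to one word followed by the
  inverse of another.\<close>

lemma free_basis_hom:
  assumes "group G" and "group Q" and B: "free_basis G B" and h: "h \<in> B \<rightarrow> carrier Q"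
  shows "\<exists>\<theta> \<in> hom G Q. \<forall>b \<in> B. \<theta> b = h b"
proof -
  interpret G: group G by fact
  interpret Q: group Q by fact
  have BG: "B \<subseteq> carrier G" and gen: "generate G B = carrier G" using B by (simp_all add: free_basis_def)
  let ?e = "\<lambda>w. word_eval Q (map (apsnd h) w)"
  have sub: "snd ` set (map (apsnd h) w) \<subseteq> carrier Q" if "snd ` set w \<subseteq> B" for w
    unfolding snd_set_map_apsnd using that h by blast
  have unique: "?e v = ?e w" if v: "snd ` set v \<subseteq> B" and w: "snd ` set w \<subseteq> B"
    and eq: "word_eval G v = word_eval G w" for v w
  proof -
    let ?i = "rev (map (apfst Not) w)"
    have i: "snd ` set ?i \<subseteq> B" using w by (simp only: set_rev snd_set_map_apfst)
    have cl: "word_eval G w \<in> carrier G" using w BG G.word_eval_closed by blast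
    have "word_eval G (v @ ?i) = \<one>\<^bsub>G\<^esub>"
      using cl eq G.word_eval_append[OF order_trans[OF v BG] order_trans[OF i BG]]
        G.word_eval_inverse[OF order_trans[OF w BG]] by simp
    then have "?e (v @ ?i) = \<one>\<^bsub>Q\<^esub>"
      using v i by (intro free_basis_word_eval_one[OF assms(1,2) B h]) (simp_all only: set_append image_Un Un_least)
    moreover have "map (apsnd h) ?i = rev (map (apfst Not) (map (apsnd h) w))"
      by (simp add: rev_map)
    ultimately have "?e v \<otimes>\<^bsub>Q\<^esub> inv\<^bsub>Q\<^esub> ?e w = \<one>\<^bsub>Q\<^esub>"
      using Q.word_eval_append[OF sub[OF v] sub[OF i]] Q.word_eval_inverse[OF sub[OF w]] by simp
    then show ?thesis
      using Q.word_eval_closed[OF sub[OF v]] Q.word_eval_closed[OF sub[OF w]]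
      by (metis Q.inv_closed Q.inv_inv Q.inv_equality)
  qed
  define W where "W g = (SOME w. snd ` set w \<subseteq> B \<and> word_eval G w = g)" for g
  have W: "snd ` set (W g) \<subseteq> B" "word_eval G (W g) = g" if "g \<in> carrier G" for g
    using someI_ex[OF G.generate_word_eval[OF BG, of g]] that unfolding W_def gen by auto
  define \<theta> where "\<theta> g = ?e (W g)" for g
  have \<theta>: "\<theta> g = ?e w" if "snd ` set w \<subseteq> B" "word_eval G w = g" for g w
  proof -
    have "g \<in> carrier G" using that BG G.word_eval_closed[of w] by auto
    then show ?thesis unfolding \<theta>_def using unique[of "W g" w] W[of g] that by simp
  qed
  have "\<theta> \<in> hom G Q"
  proof (rule homI)
    fix x assume "x \<in> carrier G"
    then show "\<theta> x \<in> carrier Q" unfolding \<theta>_def using Q.word_eval_closed[OF sub] W by blast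
  next
    fix x y assume x: "x \<in> carrier G" and y: "y \<in> carrier G"
    have "word_eval G (W x @ W y) = x \<otimes>\<^bsub>G\<^esub> y"
      using W[OF x] W[OF y] BG G.word_eval_append[of "W x" "W y"] by auto
    then have "\<theta> (x \<otimes>\<^bsub>G\<^esub> y) = ?e (W x @ W y)" using W x y by (intro \<theta>) auto
    then show "\<theta> (x \<otimes>\<^bsub>G\<^esub> y) = \<theta> x \<otimes>\<^bsub>Q\<^esub> \<theta> y"
      using Q.word_eval_append[OF sub[OF W(1)[OF x]] sub[OF W(1)[OF y]]] by (simp add: \<theta>_def)
  qed
  moreover have "\<theta> b = h b" if b: "b \<in> B" for b
  proof -
    have "b \<in> carrier G" "h b \<in> carrier Q" using b BG h by auto
    then show ?thesis using b \<theta>[of "[(True, b)]" b] by (simp add: word_eval_Nil word_eval_Cons)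
  qed
  ultimately show ?thesis by blast
qed

section \<open>Commutators and the lower central series\<close>

definition commutator :: "('a, 'b) monoid_scheme \<Rightarrow> 'a \<Rightarrow> 'a \<Rightarrow> 'a" where
  "commutator G x y = x \<otimes>\<^bsub>G\<^esub> y \<otimes>\<^bsub>G\<^esub> inv\<^bsub>G\<^esub> x \<otimes>\<^bsub>G\<^esub> inv\<^bsub>G\<^esub> y"

lemma commutator_set_eq: "commutator_set G H K = {commutator G h k |h k. h \<in> H \<and> k \<in> K}"
  by (auto simp: commutator_set_def commutator_def)

context group
begin

lemma commutator_closed [simp]:
  "x \<in> carrier G \<Longrightarrow> y \<in> carrier G \<Longrightarrow> commutator G x y \<in> carrier G"
  by (simp add: commutator_def)

lemma commutator_eq:
  "x \<in> carrier G \<Longrightarrow> y \<in> carrier G \<Longrightarrow> x \<otimes> y = commutator G x y \<otimes> (y \<otimes> x)"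
  by (simp add: commutator_def m_assoc l_cancel_inv l_cancel_inv')

lemma commutator_inv:
  "x \<in> carrier G \<Longrightarrow> y \<in> carrier G \<Longrightarrow> inv (commutator G x y) = commutator G y x"
  by (simp add: commutator_def m_assoc inv_mult_group)

lemma normal_lcs: "lcs G n \<lhd> G"
proof (induction n)
  case 0
  show ?case by (rule normal_invI) (simp_all add: subgroup_self)
next
  case (Suc n)
  interpret N: normal "lcs G n" G by (rule Suc)
  have conj: "g \<otimes> c \<otimes> inv g \<in> commutator_set G (lcs G n) (carrier G)"
    if "c \<in> commutator_set G (lcs G n) (carrier G)" and g: "g \<in> carrier G" for c g
  proof -
    obtain h k where h: "h \<in> lcs G n" and k: "k \<in> carrier G" and c: "c = commutator G h k"
      using \<open>c \<in> _\<close> by (auto simp: commutator_set_eq)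
    have hG: "h \<in> carrier G" using h N.subset by auto
    have "g \<otimes> c \<otimes> inv g = commutator G (g \<otimes> h \<otimes> inv g) (g \<otimes> k \<otimes> inv g)"
      using hG k g by (simp add: c commutator_def m_assoc inv_mult_group l_cancel_inv l_cancel_inv')
    then show ?thesis using N.inv_op_closed2[OF g h] g k by (auto simp: commutator_set_eq)
  qed
  have "commutator_set G (lcs G n) (carrier G) \<subseteq> carrier G"
    using N.subset by (auto simp: commutator_set_eq)
  then show ?case using normal_generateI conj by simp
qed

lemma lcs_subset: "lcs G n \<subseteq> carrier G"
  and subgroup_lcs: "subgroup (lcs G n) G"
  using normal_lcs[of n] normal_imp_subgroup subgroup.subset by blast+

lemma lcs_closed: "x \<in> lcs G n \<Longrightarrow> x \<in> carrier G"
  using lcs_subset by blast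

lemma commutator_in_lcs:
  assumes "h \<in> lcs G n" "k \<in> carrier G"
  shows "commutator G h k \<in> lcs G (Suc n)" "commutator G k h \<in> lcs G (Suc n)"
proof -
  show 1: "commutator G h k \<in> lcs G (Suc n)"
    using assms by (auto intro: generate.incl simp: commutator_set_eq)
  show "commutator G k h \<in> lcs G (Suc n)"
    using subgroup.m_inv_closed[OF subgroup_lcs 1] assms lcs_closed by (simp add: commutator_inv)
qed

lemma lcs_Suc_subset: "lcs G (Suc n) \<subseteq> lcs G n"
proof -
  interpret N: normal "lcs G n" G by (rule normal_lcs)
  have "commutator G h k \<in> lcs G n" if h: "h \<in> lcs G n" and k: "k \<in> carrier G" for h k
  proof -
    have "commutator G h k = h \<otimes> (k \<otimes> inv h \<otimes> inv k)"
      using h k N.mem_carrier by (simp add: commutator_def m_assoc)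
    then show ?thesis using N.inv_op_closed2[OF k, of "inv h"] h by simp
  qed
  then show ?thesis by (auto intro!: generate_subgroup_incl[OF _ subgroup_lcs] simp: commutator_set_eq)
qed

lemma lcs_antimono: "m \<le> n \<Longrightarrow> lcs G n \<subseteq> lcs G m"
  using lift_Suc_antimono_le[of "lcs G"] lcs_Suc_subset by blast

text \<open>This transfers congruences found in the subgroup generated by two elements to the whole
  group.\<close>

lemma lcs_subgroup_subset:
  assumes "subgroup H G"
  shows "lcs (G\<lparr>carrier := H\<rparr>) n \<subseteq> lcs G n"
proof (induction n)
  case 0
  then show ?case using subgroup.subset[OF assms] by simp
next
  case (Suc n)
  interpret H: group "G\<lparr>carrier := H\<rparr>" by (rule subgroup_imp_group[OF assms])
  have comm: "commutator (G\<lparr>carrier := H\<rparr>) x y = commutator G x y" if "x \<in> H" "y \<in> H" for x y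
    using that assms by (simp add: commutator_def m_inv_consistent)
  have sub: "lcs (G\<lparr>carrier := H\<rparr>) n \<subseteq> H" using H.lcs_subset[of n] by simp
  let ?S = "commutator_set (G\<lparr>carrier := H\<rparr>) (lcs (G\<lparr>carrier := H\<rparr>) n) H"
  have "?S \<subseteq> H" using H.commutator_closed sub by (auto simp: commutator_set_eq)
  then have "generate (G\<lparr>carrier := H\<rparr>) ?S = generate G ?S"
    by (rule generate_consistent[OF _ assms])
  also have "?S \<subseteq> commutator_set G (lcs G n) (carrier G)"
    using Suc sub comm subgroup.subset[OF assms] by (fastforce simp: commutator_set_eq)
  then have "generate G ?S \<subseteq> generate G (commutator_set G (lcs G n) (carrier G))"
    by (rule mono_generate)
  finally show ?case by simp
qed

definition central :: "'a \<Rightarrow> bool" where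
  "central c \<longleftrightarrow> c \<in> carrier G \<and> (\<forall>z \<in> carrier G. c \<otimes> z = z \<otimes> c)"

lemma centralD: "central c \<Longrightarrow> z \<in> carrier G \<Longrightarrow> z \<otimes> c = c \<otimes> z"
  by (simp add: central_def)

text \<open>In general the second factor appears conjugated by \<open>x\<close>; centrality removes
  the conjugation.\<close>

lemma commutator_mult_right:
  assumes [simp]: "k \<in> carrier G" "x \<in> carrier G" "y \<in> carrier G" and c: "central (commutator G k y)"
  shows "commutator G k (x \<otimes> y) = commutator G k x \<otimes> commutator G k y"
proof -
  have "commutator G k (x \<otimes> y) = commutator G k x \<otimes> (x \<otimes> commutator G k y \<otimes> inv x)"
    by (simp add: commutator_def m_assoc inv_mult_group l_cancel_inv l_cancel_inv')
  also have "x \<otimes> commutator G k y \<otimes> inv x = commutator G k y"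
    by (simp add: centralD[OF c] m_assoc)
  finally show ?thesis .
qed

lemma commutator_mult_left:
  assumes [simp]: "k \<in> carrier G" "l \<in> carrier G" "x \<in> carrier G" and c: "central (commutator G l x)"
  shows "commutator G (k \<otimes> l) x = commutator G l x \<otimes> commutator G k x"
proof -
  have "commutator G (k \<otimes> l) x = (k \<otimes> commutator G l x \<otimes> inv k) \<otimes> commutator G k x"
    by (simp add: commutator_def m_assoc inv_mult_group l_cancel_inv l_cancel_inv')
  also have "k \<otimes> commutator G l x \<otimes> inv k = commutator G l x"
    by (simp add: centralD[OF c] m_assoc)
  finally show ?thesis .
qed

lemma commutator_one:
  "x \<in> carrier G \<Longrightarrow> commutator G x \<one> = \<one>" "x \<in> carrier G \<Longrightarrow> commutator G \<one> x = \<one>"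
  by (simp_all add: commutator_def)

lemma right_inverse_unique:
  "x \<otimes> y = \<one> \<Longrightarrow> x \<in> carrier G \<Longrightarrow> y \<in> carrier G \<Longrightarrow> y = inv x"
  by (metis inv_equality inv_inv)

lemma commutator_inv_right:
  assumes "k \<in> carrier G" "x \<in> carrier G" "central (commutator G k (inv x))"
  shows "commutator G k (inv x) = inv (commutator G k x)"
  using commutator_mult_right[of k x "inv x"] assms
  by (intro right_inverse_unique) (simp_all add: commutator_one)

lemma commutator_inv_left:
  assumes "k \<in> carrier G" "x \<in> carrier G" "central (commutator G k x)"
  shows "commutator G (inv k) x = inv (commutator G k x)"
  using commutator_mult_left[of "inv k" k x] assms
  by (intro right_inverse_unique) (simp_all add: commutator_one)

text \<open>Central commutators are multiplicative in both arguments. So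
  \<open>commutator G k x\<close> can be expanded along a word for \<open>k\<close> in
  \<open>a\<close> and \<open>b\<close>, and all factors belonging to \<open>a\<close>, respectively
  to \<open>b\<close>, merge into a single commutator.\<close>

lemma generate_central_commutators:
  assumes a: "a \<in> carrier G" and b: "b \<in> carrier G" and gen: "generate G {a, b} = carrier G"
    and A: "subgroup A G"
    and cen: "\<And>k x. k \<in> carrier G \<Longrightarrow> x \<in> A \<Longrightarrow> central (commutator G k x)"
  shows "generate G (commutator_set G A (carrier G)) \<subseteq>
    {commutator G a x \<otimes> commutator G b y |x y. x \<in> A \<and> y \<in> A}" (is "_ \<subseteq> ?S")
proof (rule generate_subgroup_incl)
  interpret A: subgroup A G by (rule A)
  note [simp] = a b
  have S: "commutator G a x \<otimes> commutator G b y \<in> ?S" if "x \<in> A" "y \<in> A" for x y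
    using that by blast
  have mult: "s \<otimes> s' \<in> ?S" if s: "s \<in> ?S" "s' \<in> ?S" for s s'
  proof -
    obtain x y x' y' where A [simp]: "x \<in> A" "y \<in> A" "x' \<in> A" "y' \<in> A"
      and eq: "s = commutator G a x \<otimes> commutator G b y" "s' = commutator G a x' \<otimes> commutator G b y'"
      using s by blast
    have "s \<otimes> s' = commutator G a x \<otimes> ((commutator G b y \<otimes> commutator G a x') \<otimes> commutator G b y')"
      by (simp add: eq m_assoc)
    also have "commutator G b y \<otimes> commutator G a x' = commutator G a x' \<otimes> commutator G b y"
      by (rule centralD) (simp_all add: cen)
    finally have "s \<otimes> s' = commutator G a (x \<otimes> x') \<otimes> commutator G b (y \<otimes> y')"
      by (simp add: commutator_mult_right cen m_assoc)
    then show ?thesis using S by simp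
  qed
  have inv: "inv s \<in> ?S" if s: "s \<in> ?S" for s
  proof -
    obtain x y where A [simp]: "x \<in> A" "y \<in> A" and eq: "s = commutator G a x \<otimes> commutator G b y"
      using s by blast
    have "inv s = inv (commutator G a x) \<otimes> inv (commutator G b y)"
      using centralD[OF cen[OF b A(2)], of "commutator G a x"] by (simp add: eq inv_mult_group[symmetric])
    moreover have xy: "inv x \<in> A" "inv y \<in> A" using subgroup.m_inv_closed[OF \<open>subgroup A G\<close>] by simp_all
    moreover have "commutator G a (inv x) = inv (commutator G a x)" "commutator G b (inv y) = inv (commutator G b y)"
      using commutator_inv_right[OF a A.mem_carrier[OF \<open>x \<in> A\<close>] cen[OF a xy(1)]]
        commutator_inv_right[OF b A.mem_carrier[OF \<open>y \<in> A\<close>] cen[OF b xy(2)]] by simp_all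
    ultimately show ?thesis using S[OF xy] by simp
  qed
  have one: "\<one> \<in> ?S" using S[of \<one> \<one>] by (simp add: commutator_one)
  show "subgroup ?S G"
    by (rule subgroupI) (use one mult inv in \<open>auto\<close>)
  have gens: "commutator G k x \<in> ?S" if "k \<in> generate G {a, b}" and x: "x \<in> A" for k x
    using that(1)
  proof (induction rule: generate.induct)
    case one
    then show ?case using \<open>\<one> \<in> ?S\<close> x by (simp add: commutator_one)
  next
    case (incl h)
    then show ?case using S[of x \<one>] S[of \<one> x] x by (auto simp: commutator_one)
  next
    case (inv h)
    then have "commutator G h x \<in> ?S" "h \<in> carrier G"
      using S[of x \<one>] S[of \<one> x] x by (auto simp: commutator_one)
    then show ?case using \<open>\<And>s. s \<in> ?S \<Longrightarrow> inv s \<in> ?S\<close> x by (simp add: commutator_inv_left cen)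
  next
    case (eng h k)
    then show ?case using mult x gen by (simp add: commutator_mult_left cen)
  qed
  show "commutator_set G A (carrier G) \<subseteq> ?S"
  proof
    fix c assume "c \<in> commutator_set G A (carrier G)"
    then obtain h k where h: "h \<in> A" and k: "k \<in> carrier G" and c: "c = commutator G h k"
      by (auto simp: commutator_set_eq)
    have "c = inv (commutator G k h)" using h k c by (simp add: commutator_inv)
    then show "c \<in> ?S" using gens[of k h] h k inv gen by simp
  qed
qed

end

section \<open>Quotients by the lower central series and successive approximation\<close>

declare lcs.simps(2) [simp del] mult_FactGroup [simp del] one_FactGroup [simp del]

lemma (in group_hom) hom_commutator:
  "x \<in> carrier G \<Longrightarrow> y \<in> carrier G \<Longrightarrow> h (commutator G x y) = commutator H (h x) (h y)"
  by (simp add: commutator_def)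

context group
begin

lemma group_hom_Mod: "N \<lhd> G \<Longrightarrow> group_hom G (G Mod N) (\<lambda>x. N #> x)"
  by (simp add: group_hom_def group_hom_axioms_def normal.factorgroup_is_group
      normal.r_coset_hom_Mod is_group)

lemma carrier_Mod: "carrier (G Mod N) = (\<lambda>x. N #> x) ` carrier G"
  by (auto simp: FactGroup_def RCOSETS_def)

lemma rcos_eq_mono:
  assumes "subgroup N G" "subgroup M G" "N \<subseteq> M" "x \<in> carrier G" "y \<in> carrier G" "N #> x = N #> y"
  shows "M #> x = M #> y"
proof -
  have "y \<in> N #> x" using assms rcos_self by blast
  then have "y \<in> M #> x" using assms(3) by (auto simp: r_coset_def)
  then show ?thesis using repr_independence assms by blast
qed

lemma lcs_rcos_eq_mono:
  "m \<le> n \<Longrightarrow> x \<in> carrier G \<Longrightarrow> y \<in> carrier G \<Longrightarrow> lcs G n #> x = lcs G n #> y \<Longrightarrow>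
    lcs G m #> x = lcs G m #> y"
  by (rule rcos_eq_mono[OF subgroup_lcs subgroup_lcs lcs_antimono])

lemma lcs_rcos_mult_cong:
  assumes "x \<in> carrier G" "x' \<in> carrier G" "y \<in> carrier G" "y' \<in> carrier G"
    "lcs G n #> x = lcs G n #> x'" "lcs G n #> y = lcs G n #> y'"
  shows "lcs G n #> (x \<otimes> y) = lcs G n #> (x' \<otimes> y')"
  using assms normal.rcos_sum[OF normal_lcs] by metis

lemma lcs_rcos_mult_absorb:
  assumes "x \<in> carrier G" "y \<in> lcs G n"
  shows "lcs G n #> (x \<otimes> y) = lcs G n #> x"
proof -
  have "lcs G n #> (x \<otimes> y) = lcs G n #> (x \<otimes> \<one>)"
    using assms lcs_closed coset_join2[OF _ subgroup_lcs, of y n]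
      coset_join2[OF one_closed subgroup_lcs[of n]] subgroup.one_closed[OF subgroup_lcs[of n]]
    by (intro lcs_rcos_mult_cong) auto
  then show ?thesis using assms by simp
qed

lemma lcs_rcos_commutator_cong:
  assumes "x \<in> carrier G" "x' \<in> carrier G" "y \<in> carrier G" "y' \<in> carrier G"
    "lcs G n #> x = lcs G n #> x'" "lcs G n #> y = lcs G n #> y'"
  shows "lcs G n #> commutator G x y = lcs G n #> commutator G x' y'"
  using assms group_hom.hom_commutator[OF group_hom_Mod[OF normal_lcs]] by metis

text \<open>The commutator of \<open>c\<close> with any element lies in the next term and dies in
  the quotient.\<close>

lemma central_mod_lcs:
  assumes c: "c \<in> lcs G n"
  shows "group.central (G Mod lcs G (Suc n)) (lcs G (Suc n) #> c)"
proof -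
  let ?N = "lcs G (Suc n)"
  interpret h: group_hom G "G Mod ?N" "\<lambda>x. ?N #> x" by (rule group_hom_Mod[OF normal_lcs])
  have cG: "c \<in> carrier G" using c lcs_closed by blast
  have "(?N #> c) \<otimes>\<^bsub>G Mod ?N\<^esub> (?N #> z) = (?N #> z) \<otimes>\<^bsub>G Mod ?N\<^esub> (?N #> c)" if z: "z \<in> carrier G" for z
  proof -
    have "?N #> commutator G c z = \<one>\<^bsub>G Mod ?N\<^esub>"
      using coset_join2[OF _ subgroup_lcs commutator_in_lcs(1)[OF c z]] cG z by (simp add: one_FactGroup)
    moreover have "?N #> (c \<otimes> z) = (?N #> commutator G c z) \<otimes>\<^bsub>G Mod ?N\<^esub> (?N #> (z \<otimes> c))"
      using cG z by (subst commutator_eq) (simp_all)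
    ultimately show ?thesis using cG z by simp
  qed
  then show ?thesis unfolding h.H.central_def carrier_Mod using cG by (auto)
qed

text \<open>Modulo \<open>lcs G (Suc (Suc n))\<close> every commutator with an element of
  \<open>lcs G n\<close> is central, so \<open>generate_central_commutators\<close> applies to the
  image of \<open>lcs G n\<close> in that quotient.\<close>

lemma lcs_Suc_mod:
  assumes a: "a \<in> carrier G" and b: "b \<in> carrier G" and gen: "generate G {a, b} = carrier G"
    and g: "g \<in> lcs G (Suc n)"
  shows "\<exists>x \<in> lcs G n. \<exists>y \<in> lcs G n.
    lcs G (Suc (Suc n)) #> g = lcs G (Suc (Suc n)) #> (commutator G a x \<otimes> commutator G b y)"
proof -
  define N where "N = lcs G (Suc (Suc n))"
  let ?M = "G Mod N" and ?\<pi> = "\<lambda>x. N #> x" and ?A = "(\<lambda>x. N #> x) ` lcs G n"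
  have N: "N \<lhd> G" unfolding N_def by (rule normal_lcs)
  interpret h: group_hom G ?M ?\<pi> by (rule group_hom_Mod[OF N])
  have com: "N #> commutator G k x = commutator ?M (N #> k) (N #> x)"
    if "k \<in> carrier G" "x \<in> carrier G" for k x
    using h.hom_commutator that by blast
  have A: "subgroup ?A ?M" by (rule h.subgroup_img_is_subgroup[OF subgroup_lcs])
  have gen': "generate ?M {N #> a, N #> b} = carrier ?M"
    using h.generate_img[of "{a, b}"] a b gen by (simp add: carrier_Mod)
  have cen: "h.H.central (commutator ?M k x)" if "k \<in> carrier ?M" "x \<in> ?A" for k x
  proof -
    obtain k' x' where "k' \<in> carrier G" "k = N #> k'" "x' \<in> lcs G n" "x = N #> x'"
      using \<open>k \<in> _\<close> \<open>x \<in> _\<close> unfolding carrier_Mod by blast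
    then show ?thesis
      using central_mod_lcs[OF commutator_in_lcs(2)[of x' n k']] com[of k' x'] lcs_closed[of x' n]
      unfolding N_def by simp
  qed
  have "?\<pi> ` commutator_set G (lcs G n) (carrier G) \<subseteq> commutator_set ?M ?A (carrier ?M)"
  proof (rule image_subsetI)
    fix c assume "c \<in> commutator_set G (lcs G n) (carrier G)"
    then obtain l k where lk: "l \<in> lcs G n" "k \<in> carrier G" "c = commutator G l k"
      unfolding commutator_set_eq by blast
    then have "N #> c = commutator ?M (N #> l) (N #> k)" using com lcs_closed by blast
    then show "N #> c \<in> commutator_set ?M ?A (carrier ?M)"
      unfolding commutator_set_eq carrier_Mod using lk by blast
  qed
  then have "generate ?M (?\<pi> ` commutator_set G (lcs G n) (carrier G)) \<subseteq>
      generate ?M (commutator_set ?M ?A (carrier ?M))" by (rule h.H.mono_generate)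
  moreover have "?\<pi> g \<in> generate ?M (?\<pi> ` commutator_set G (lcs G n) (carrier G))"
  proof -
    have "commutator_set G (lcs G n) (carrier G) \<subseteq> carrier G"
      using lcs_closed[of _ n] by (auto simp: commutator_set_eq)
    from h.generate_img[OF this] show ?thesis using g by (simp add: lcs.simps(2))
  qed
  ultimately have "?\<pi> g \<in> generate ?M (commutator_set ?M ?A (carrier ?M))" by blast
  also have "\<dots> \<subseteq> {commutator ?M (N #> a) x \<otimes>\<^bsub>?M\<^esub> commutator ?M (N #> b) y |x y. x \<in> ?A \<and> y \<in> ?A}"
    by (rule h.H.generate_central_commutators) (use a b gen' A cen in auto)
  finally obtain x y where xy: "x \<in> lcs G n" "y \<in> lcs G n"
    and eq: "?\<pi> g = commutator ?M (N #> a) (N #> x) \<otimes>\<^bsub>?M\<^esub> commutator ?M (N #> b) (N #> y)"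
    by blast
  have "?\<pi> g = N #> (commutator G a x \<otimes> commutator G b y)"
    using a b xy lcs_closed[of _ n] by (simp add: eq com)
  then show ?thesis using xy unfolding N_def by blast
qed

text \<open>The error \<open>g\<close> of the current approximation lies in
  \<open>lcs G (Suc n)\<close>. One level further it is a product of two commutators with
  \<open>a\<close> and \<open>b\<close>, which are absorbed by multiplying \<open>u\<close> and
  \<open>v\<close> with elements of \<open>lcs G n\<close>.\<close>

lemma lcs_commutator_step:
  assumes a: "a \<in> carrier G" and b: "b \<in> carrier G" and gen: "generate G {a, b} = carrier G"
    and u: "u \<in> carrier G" and v: "v \<in> carrier G" and w: "w \<in> carrier G"
    and eq: "lcs G (Suc n) #> w = lcs G (Suc n) #> (commutator G a u \<otimes> commutator G b v)"
  shows "\<exists>x \<in> lcs G n. \<exists>y \<in> lcs G n. lcs G (Suc (Suc n)) #> w =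
    lcs G (Suc (Suc n)) #> (commutator G a (u \<otimes> x) \<otimes> commutator G b (v \<otimes> y))"
proof -
  let ?c = "commutator G a u \<otimes> commutator G b v"
  have c: "?c \<in> carrier G" using a b u v by simp
  have "w \<in> lcs G (Suc n) #> ?c"
    using eq rcos_self[OF w subgroup_lcs, of "Suc n"] by simp
  then obtain g where g: "g \<in> lcs G (Suc n)" and wg: "w = g \<otimes> ?c" unfolding r_coset_def by auto
  have gG: "g \<in> carrier G" using g lcs_closed by blast
  obtain x y where x: "x \<in> lcs G n" and y: "y \<in> lcs G n"
    and gxy: "lcs G (Suc (Suc n)) #> g = lcs G (Suc (Suc n)) #> (commutator G a x \<otimes> commutator G b y)"
    using lcs_Suc_mod[OF a b gen g] by blast
  have xy: "x \<in> carrier G" "y \<in> carrier G" using x y lcs_closed by blast+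
  define N where "N = lcs G (Suc (Suc n))"
  let ?M = "G Mod N"
  interpret h: group_hom G ?M "\<lambda>x. N #> x" unfolding N_def by (rule group_hom_Mod[OF normal_lcs])
  have cx: "h.H.central (N #> commutator G a x)" and cy: "h.H.central (N #> commutator G b y)"
    unfolding N_def using central_mod_lcs commutator_in_lcs(2) x y a b by blast+
  let ?p = "\<lambda>x. N #> x"
  have "?p w = ?p (commutator G a x) \<otimes>\<^bsub>?M\<^esub> ?p (commutator G b y) \<otimes>\<^bsub>?M\<^esub> (?p (commutator G a u) \<otimes>\<^bsub>?M\<^esub> ?p (commutator G b v))"
    using gxy a b u v xy gG by (simp add: wg flip: N_def)
  \<comment> \<open>Both correction factors are central, so each can be moved next to the commutator
    with the same generator.\<close>
  also have "\<dots> = ?p (commutator G a u) \<otimes>\<^bsub>?M\<^esub> ?p (commutator G a x) \<otimes>\<^bsub>?M\<^esub> (?p (commutator G b v) \<otimes>\<^bsub>?M\<^esub> ?p (commutator G b y))"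
  proof -
    let ?X = "?p (commutator G a x)" and ?Y = "?p (commutator G b y)"
      and ?U = "?p (commutator G a u)" and ?V = "?p (commutator G b v)"
    have cl: "?X \<in> carrier ?M" "?Y \<in> carrier ?M" "?U \<in> carrier ?M" "?V \<in> carrier ?M"
      using a b u v xy by auto
    have "?X \<otimes>\<^bsub>?M\<^esub> ?Y \<otimes>\<^bsub>?M\<^esub> (?U \<otimes>\<^bsub>?M\<^esub> ?V) = ?X \<otimes>\<^bsub>?M\<^esub> (?Y \<otimes>\<^bsub>?M\<^esub> (?U \<otimes>\<^bsub>?M\<^esub> ?V))"
      using cl by (simp add: h.H.m_assoc)
    also have "?Y \<otimes>\<^bsub>?M\<^esub> (?U \<otimes>\<^bsub>?M\<^esub> ?V) = (?U \<otimes>\<^bsub>?M\<^esub> ?V) \<otimes>\<^bsub>?M\<^esub> ?Y"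
      by (rule h.H.centralD[OF cy, symmetric]) (use cl in auto)
    also have "?X \<otimes>\<^bsub>?M\<^esub> (?U \<otimes>\<^bsub>?M\<^esub> ?V \<otimes>\<^bsub>?M\<^esub> ?Y) = (?X \<otimes>\<^bsub>?M\<^esub> ?U) \<otimes>\<^bsub>?M\<^esub> (?V \<otimes>\<^bsub>?M\<^esub> ?Y)"
      using cl by (simp add: h.H.m_assoc)
    also have "?X \<otimes>\<^bsub>?M\<^esub> ?U = ?U \<otimes>\<^bsub>?M\<^esub> ?X" by (rule h.H.centralD[OF cx, symmetric]) (use cl in auto)
    finally show ?thesis .
  qed
  also have "?p (commutator G a u) \<otimes>\<^bsub>?M\<^esub> ?p (commutator G a x) = ?p (commutator G a (u \<otimes> x))"
    using h.H.commutator_mult_right[of "?p a" "?p u" "?p x"] cx a u xy by (simp add: h.hom_commutator)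
  also have "?p (commutator G b v) \<otimes>\<^bsub>?M\<^esub> ?p (commutator G b y) = ?p (commutator G b (v \<otimes> y))"
    using h.H.commutator_mult_right[of "?p b" "?p v" "?p y"] cy b v xy by (simp add: h.hom_commutator)
  finally have "?p w = ?p (commutator G a (u \<otimes> x) \<otimes> commutator G b (v \<otimes> y))"
    using a b u v xy by simp
  then show ?thesis unfolding N_def using x y by blast
qed

text \<open>Iteration of \<open>lcs_commutator_step\<close>, starting from trivial \<open>u\<close>
  and \<open>v\<close>, which suffice for \<open>w 0\<close>. The corrections lie ever deeper in the
  lower central series, so \<open>u\<close> and \<open>v\<close> converge in the completion.\<close>

lemma lcs_commutator_sequence:
  assumes a: "a \<in> carrier G" and b: "b \<in> carrier G" and gen: "generate G {a, b} = carrier G"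
    and w: "\<And>n. w n \<in> carrier G" and w0: "w 0 \<in> lcs G 2"
    and coh: "\<And>n. lcs G (n + 2) #> w (Suc n) = lcs G (n + 2) #> w n"
  shows "\<exists>u v. \<forall>n. u n \<in> lcs G 1 \<and> v n \<in> lcs G 1 \<and>
    lcs G (n + 2) #> w n = lcs G (n + 2) #> (commutator G a (u n) \<otimes> commutator G b (v n)) \<and>
    lcs G n #> u (Suc n) = lcs G n #> u n \<and> lcs G n #> v (Suc n) = lcs G n #> v n"
proof -
  let ?P = "\<lambda>n z. fst z \<in> lcs G 1 \<and> snd z \<in> lcs G 1 \<and>
    lcs G (n + 2) #> w n = lcs G (n + 2) #> (commutator G a (fst z) \<otimes> commutator G b (snd z))"
  let ?Q = "\<lambda>n z z'. lcs G n #> fst z' = lcs G n #> fst z \<and> lcs G n #> snd z' = lcs G n #> snd z"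
  have "\<exists>f. \<forall>n. ?P n (f n) \<and> ?Q n (f n) (f (Suc n))"
  proof (rule dependent_nat_choice[where P = ?P and Q = ?Q])
    have "lcs G 2 #> w 0 = lcs G 2 #> \<one>"
      using coset_join2[OF w subgroup_lcs w0] coset_join2[OF one_closed subgroup_lcs[of 2]]
        subgroup.one_closed[OF subgroup_lcs] by simp
    then show "\<exists>z. ?P 0 z"
      using a b subgroup.one_closed[OF subgroup_lcs[of 1]]
      by (intro exI[of _ "(\<one>, \<one>)"]) (simp add: commutator_one numeral_2_eq_2)
  next
    fix z n assume P: "?P n z"
    obtain u v where z: "z = (u, v)" by fastforce
    have u: "u \<in> carrier G" "v \<in> carrier G" using P lcs_closed by (auto simp: z)
    have "lcs G (Suc (Suc n)) #> w (Suc n) = lcs G (Suc (Suc n)) #> (commutator G a u \<otimes> commutator G b v)"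
      using P coh[of n] by (simp add: z)
    from lcs_commutator_step[OF a b gen u w this]
    obtain x y where x: "x \<in> lcs G (Suc n)" and y: "y \<in> lcs G (Suc n)"
      and eq: "lcs G (Suc (Suc (Suc n))) #> w (Suc n) =
        lcs G (Suc (Suc (Suc n))) #> (commutator G a (u \<otimes> x) \<otimes> commutator G b (v \<otimes> y))" by blast
    \<comment> \<open>Corrections in \<open>lcs G (Suc n)\<close> lie both in
      \<open>lcs G 1\<close>, which preserves the invariant, and in \<open>lcs G n\<close>, which
      gives coherence.\<close>
    have x1: "x \<in> lcs G 1" "y \<in> lcs G 1" and xn: "x \<in> lcs G n" "y \<in> lcs G n"
      using x y lcs_antimono[of 1 "Suc n"] lcs_antimono[of n "Suc n"] by auto
    have "u \<otimes> x \<in> lcs G 1" "v \<otimes> y \<in> lcs G 1"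
      using P x1 subgroup.m_closed[OF subgroup_lcs] by (auto simp: z)
    then have "?P (Suc n) (u \<otimes> x, v \<otimes> y) \<and> ?Q n z (u \<otimes> x, v \<otimes> y)"
      using eq u xn by (simp add: z lcs_rcos_mult_absorb)
    then show "\<exists>z'. ?P (Suc n) z' \<and> ?Q n z z'" by blast
  qed
  then obtain f where "\<And>n. ?P n (f n)" "\<And>n. ?Q n (f n) (f (Suc n))" by blast
  then show ?thesis by (intro exI[of _ "fst \<circ> f"] exI[of _ "snd \<circ> f"]) simp
qed

end

section \<open>Pronilpotent completions\<close>

text \<open>Integer powers of a unit \<open>t\<close> whose inverse \<open>t'\<close> is given explicitly, as \<open>fps\<close> over \<open>int\<close> has no \<open>powi\<close>.\<close>

definition zpow :: "'r::comm_ring_1 \<Rightarrow> 'r \<Rightarrow> int \<Rightarrow> 'r" where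
  "zpow t t' n = (if n \<ge> 0 then t ^ nat n else t' ^ nat (- n))"

lemma zpow_0 [simp]: "zpow t t' 0 = 1"
  by (simp add: zpow_def)

lemma zpow_uminus: "zpow t t' (- n) = zpow t' t n"
  by (simp add: zpow_def)

lemma zpow_Suc:
  assumes "t * t' = 1"
  shows "zpow t t' (n + 1) = t * zpow t t' n"
proof (cases "n \<ge> 0")
  case True
  then show ?thesis by (simp add: zpow_def nat_add_distrib)
next
  case False
  define k where "k = nat (- 1 - n)"
  have k: "n = - 1 - int k" using False by (simp add: k_def)
  have "t * (t' * t' ^ k) = t' ^ k" using assms by (simp flip: mult.assoc)
  then show ?thesis by (simp add: k zpow_def nat_add_distrib)
qed

lemma zpow_add:
  assumes "t * t' = 1"
  shows "zpow t t' (m + n) = zpow t t' m * zpow t t' n"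
proof (induction m rule: int_induct[where k = 0])
  case base
  then show ?case by simp
next
  case (step1 i)
  then show ?case using zpow_Suc[OF assms, of "i + n"] zpow_Suc[OF assms, of i]
    by (simp add: algebra_simps)
next
  case (step2 i)
  have *: "zpow t t' (j - 1) = t' * zpow t t' j" for j
    using zpow_Suc[OF assms, of "j - 1"] assms by (simp add: mult.left_commute flip: mult.assoc)
  show ?case using step2 *[of "i + n"] *[of i] by (simp add: algebra_simps)
qed

lemma zpow_minus_1_dvd:
  assumes "t * t' = 1" "x dvd t - 1"
  shows "x dvd zpow t t' n - 1"
proof -
  have pow: "x dvd c ^ k - 1" if "x dvd c - 1" for c k
    using that by (metis power_diff_1_eq dvd_mult2)
  have "t' - 1 = - t' * (t - 1)" using assms(1) by (simp add: algebra_simps)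
  then have "x dvd t' - 1" using assms(2) by simp
  then show ?thesis using pow assms(2) by (simp add: zpow_def)
qed

text \<open>The semidirect product of the integers with the additive group of the ring, where
  \<open>m\<close> acts as multiplication by the \<open>m\<close>-th power of
  \<open>t\<close>.\<close>

definition affine_group :: "'r::comm_ring_1 \<Rightarrow> 'r \<Rightarrow> (int \<times> 'r) monoid" where
  "affine_group t t' = \<lparr>carrier = UNIV,
     monoid.mult = (\<lambda>(m, x) (n, y). (m + n, x + zpow t t' m * y)), one = (0, 0)\<rparr>"

lemma group_affine_group:
  assumes "t * t' = 1"
  shows "group (affine_group t t')"
proof (rule groupI)
  fix x assume "x \<in> carrier (affine_group t t')"
  obtain m a where x: "x = (m, a)" by fastforce
  show "\<exists>y \<in> carrier (affine_group t t'). y \<otimes>\<^bsub>affine_group t t'\<^esub> x = \<one>\<^bsub>affine_group t t'\<^esub>"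
    by (rule bexI[of _ "(- m, - zpow t t' (- m) * a)"]) (simp_all add: affine_group_def x)
qed (auto simp: affine_group_def zpow_add[OF assms] algebra_simps)

section \<open>Points of the completion as limits of sequences\<close>

context group
begin

text \<open>Representatives of a point of the inverse limit: only the class of \<open>g n\<close>
  modulo \<open>lcs G n\<close> matters, so the point can be handled through elements of
  \<open>G\<close>.\<close>

definition lcs_coherent :: "(nat \<Rightarrow> 'a) \<Rightarrow> bool" where
  "lcs_coherent g \<longleftrightarrow> (\<forall>n. g n \<in> carrier G \<and> lcs G n #> g (Suc n) = lcs G n #> g n)"

definition completion_lim :: "(nat \<Rightarrow> 'a) \<Rightarrow> nat \<Rightarrow> 'a set" where
  "completion_lim g = (\<lambda>n. lcs G n #> g n)"

lemma lcs_coherentD: "lcs_coherent g \<Longrightarrow> g n \<in> carrier G"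
  "lcs_coherent g \<Longrightarrow> lcs G n #> g (Suc n) = lcs G n #> g n"
  by (simp_all add: lcs_coherent_def)

lemma lcs_coherent_const: "x \<in> carrier G \<Longrightarrow> lcs_coherent (\<lambda>_. x)"
  by (simp add: lcs_coherent_def)

lemma lcs_coherent_mult: "lcs_coherent g \<Longrightarrow> lcs_coherent h \<Longrightarrow> lcs_coherent (\<lambda>n. g n \<otimes> h n)"
  unfolding lcs_coherent_def by (metis m_closed lcs_rcos_mult_cong)

lemma lcs_coherent_commutator:
  "lcs_coherent g \<Longrightarrow> lcs_coherent h \<Longrightarrow> lcs_coherent (\<lambda>n. commutator G (g n) (h n))"
  unfolding lcs_coherent_def by (metis commutator_closed lcs_rcos_commutator_cong)

lemma completion_lim_closed:
  assumes "lcs_coherent g"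
  shows "completion_lim g \<in> carrier (pronilpotent_completion G)"
proof -
  have "lcs G (Suc n) #> g (Suc n) \<subseteq> lcs G n #> g n" for n
    using lcs_Suc_subset[of n] lcs_coherentD(2)[OF assms, of n, symmetric] by (auto simp: r_coset_def)
  then show ?thesis
    using lcs_coherentD(1)[OF assms] rcosetsI[OF lcs_subset]
    by (simp add: pronilpotent_completion_def completion_lim_def)
qed

lemma completion_lim_mult:
  "lcs_coherent g \<Longrightarrow> lcs_coherent h \<Longrightarrow>
    completion_lim g \<otimes>\<^bsub>pronilpotent_completion G\<^esub> completion_lim h = completion_lim (\<lambda>n. g n \<otimes> h n)"
  by (simp add: pronilpotent_completion_def completion_lim_def fun_eq_iff
      normal.rcos_sum[OF normal_lcs] lcs_coherentD(1))

text \<open>Successive approximation applied to the commutators of \<open>r\<close> and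
  \<open>s\<close>; multiplying by \<open>s n \<otimes> r n\<close> turns the result into a relation
  between products.\<close>

lemma commutator_of_limits:
  assumes a: "a \<in> carrier G" and b: "b \<in> carrier G" and gen: "generate G {a, b} = carrier G"
    and r: "\<And>n. r n \<in> lcs G 1" "\<And>n. lcs G (Suc n) #> r (Suc n) = lcs G (Suc n) #> r n"
    and s: "\<And>n. s n \<in> lcs G 1" "\<And>n. lcs G (Suc n) #> s (Suc n) = lcs G (Suc n) #> s n"
  shows "\<exists>u v. (\<forall>n. u n \<in> lcs G 1) \<and> (\<forall>n. v n \<in> lcs G 1) \<and> lcs_coherent u \<and> lcs_coherent v \<and>
    (\<forall>n. lcs G n #> (r n \<otimes> s n) =
       lcs G n #> (commutator G a (u n) \<otimes> commutator G b (v n) \<otimes> (s n \<otimes> r n)))"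
proof -
  have rG: "r n \<in> carrier G" and sG: "s n \<in> carrier G" for n using r s lcs_closed by blast+
  \<comment> \<open>The shift by one supplies the congruences modulo \<open>lcs G (n + 2)\<close>
    that the approximation needs: stage \<open>Suc n\<close> of \<open>r\<close> and
    \<open>s\<close> agrees with the next stage modulo \<open>lcs G (n + 2)\<close>.\<close>
  define w where "w n = commutator G (r (Suc n)) (s (Suc n))" for n
  have wG: "w n \<in> carrier G" for n by (simp add: w_def rG sG)
  have w0: "w 0 \<in> lcs G 2"
    using commutator_in_lcs(1)[OF r(1) sG] by (simp add: w_def numeral_2_eq_2)
  have coh: "lcs G (n + 2) #> w (Suc n) = lcs G (n + 2) #> w n" for n
    using r(2)[of "Suc n"] s(2)[of "Suc n"] unfolding w_def
    by (intro lcs_rcos_commutator_cong) (simp_all add: rG sG)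
  obtain u v where uv: "\<And>n. u n \<in> lcs G 1" "\<And>n. v n \<in> lcs G 1"
    "\<And>n. lcs G (n + 2) #> w n = lcs G (n + 2) #> (commutator G a (u n) \<otimes> commutator G b (v n))"
    "\<And>n. lcs G n #> u (Suc n) = lcs G n #> u n" "\<And>n. lcs G n #> v (Suc n) = lcs G n #> v n"
    using lcs_commutator_sequence[OF a b gen, of w, OF wG w0 coh] by blast
  have uG: "u n \<in> carrier G" and vG: "v n \<in> carrier G" for n using uv lcs_closed by blast+
  have "lcs G n #> (r n \<otimes> s n) =
       lcs G n #> (commutator G a (u n) \<otimes> commutator G b (v n) \<otimes> (s n \<otimes> r n))" for n
  proof -
    have r': "lcs G n #> r (Suc n) = lcs G n #> r n" and s': "lcs G n #> s (Suc n) = lcs G n #> s n"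
      using lcs_rcos_eq_mono[of n "Suc n"] r(2) s(2) rG sG by simp_all
    have w': "lcs G n #> w n = lcs G n #> (commutator G a (u n) \<otimes> commutator G b (v n))"
      using lcs_rcos_eq_mono[of n "n + 2"] uv(3) wG a b uG vG by simp
    have "lcs G n #> (r n \<otimes> s n) = lcs G n #> (r (Suc n) \<otimes> s (Suc n))"
      by (rule lcs_rcos_mult_cong) (simp_all add: rG sG r' s')
    also have "\<dots> = lcs G n #> (w n \<otimes> (s (Suc n) \<otimes> r (Suc n)))"
      using commutator_eq[OF rG sG] by (simp add: w_def)
    also have "\<dots> = lcs G n #> (commutator G a (u n) \<otimes> commutator G b (v n) \<otimes> (s n \<otimes> r n))"
      by (intro lcs_rcos_mult_cong w') (simp_all add: rG sG wG uG vG a b r' s' lcs_rcos_mult_cong)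
    finally show ?thesis .
  qed
  then show ?thesis using uv uG vG by (intro exI[of _ u] exI[of _ v]) (simp add: lcs_coherent_def)
qed

lemma lcs_subgroup_rcos_eq:
  assumes H: "subgroup H G" and "x \<in> H" "y \<in> H"
    and eq: "lcs (G\<lparr>carrier := H\<rparr>) n #>\<^bsub>G\<lparr>carrier := H\<rparr>\<^esub> x = lcs (G\<lparr>carrier := H\<rparr>) n #>\<^bsub>G\<lparr>carrier := H\<rparr>\<^esub> y"
  shows "lcs G n #> x = lcs G n #> y"
proof (rule rcos_eq_mono)
  interpret K: group "G\<lparr>carrier := H\<rparr>" by (rule subgroup_imp_group[OF H])
  show "subgroup (lcs (G\<lparr>carrier := H\<rparr>) n) G"
    by (rule incl_subgroup[OF H K.subgroup_lcs])
  show "lcs (G\<lparr>carrier := H\<rparr>) n #> x = lcs (G\<lparr>carrier := H\<rparr>) n #> y"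
    using eq by (simp add: r_coset_def)
qed (use assms subgroup_lcs lcs_subgroup_subset subgroup.mem_carrier in auto)

lemma commutator_subgroup:
  "subgroup H G \<Longrightarrow> x \<in> H \<Longrightarrow> y \<in> H \<Longrightarrow> commutator (G\<lparr>carrier := H\<rparr>) x y = commutator G x y"
  by (simp add: commutator_def m_inv_consistent)

text \<open>Successive approximation requires that \<open>a\<close> and \<open>b\<close> generate,
  so it is carried out in the subgroup they generate. Its lower central series lies in that of
  \<open>G\<close>, and the congruences pass to \<open>G\<close>.\<close>

lemma completion_commutator_relation:
  fixes a b defines "K \<equiv> G\<lparr>carrier := generate G {a, b}\<rparr>"
  assumes a: "a \<in> carrier G" and b: "b \<in> carrier G"
    and r: "\<And>n. r n \<in> lcs K 1" "\<And>n. lcs K (Suc n) #>\<^bsub>K\<^esub> r (Suc n) = lcs K (Suc n) #>\<^bsub>K\<^esub> r n"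
    and s: "\<And>n. s n \<in> lcs K 1" "\<And>n. lcs K (Suc n) #>\<^bsub>K\<^esub> s (Suc n) = lcs K (Suc n) #>\<^bsub>K\<^esub> s n"
  shows "\<exists>u v. (\<forall>n. u n \<in> lcs G 1) \<and> (\<forall>n. v n \<in> lcs G 1) \<and> lcs_coherent u \<and> lcs_coherent v \<and>
    lcs_coherent r \<and> lcs_coherent s \<and> (\<forall>n. lcs G n #> (r n \<otimes> s n) =
       lcs G n #> (commutator G a (u n) \<otimes> commutator G b (v n) \<otimes> (s n \<otimes> r n)))"
proof -
  let ?H = "generate G {a, b}"
  have H: "subgroup ?H G" using a b by (intro generate_is_subgroup) auto
  interpret K: group K unfolding K_def by (rule subgroup_imp_group[OF H])
  have carrier_K: "carrier K = ?H" by (simp add: K_def)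
  have aH: "a \<in> ?H" "b \<in> ?H" by (auto intro: generate.incl)
  have gen: "generate K {a, b} = carrier K"
    unfolding K_def using aH by (subst generate_consistent[OF _ H]) auto
  have lcsK: "x \<in> ?H" if "x \<in> lcs K n" for x n using K.lcs_closed[OF that] by (simp add: carrier_K)
  have coh: "lcs_coherent g" if g: "K.lcs_coherent g" for g
    unfolding lcs_coherent_def
  proof (intro allI conjI)
    have gH: "g n \<in> ?H" for n using K.lcs_coherentD(1)[OF g] by (simp add: carrier_K)
    then show "g n \<in> carrier G" for n using subgroup.mem_carrier[OF H] by blast
    show "lcs G n #> g (Suc n) = lcs G n #> g n" for n
      using K.lcs_coherentD(2)[OF g] unfolding K_def by (intro lcs_subgroup_rcos_eq[OF H gH gH])
  qed
  have cohK: "K.lcs_coherent g" if "\<And>n. g n \<in> lcs K 1"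
    "\<And>n. lcs K (Suc n) #>\<^bsub>K\<^esub> g (Suc n) = lcs K (Suc n) #>\<^bsub>K\<^esub> g n" for g
    unfolding K.lcs_coherent_def
    using K.lcs_rcos_eq_mono[OF le_SucI[OF order_refl] _ _ that(2)] that(1) K.lcs_closed by blast
  obtain u v where u: "\<And>n. u n \<in> lcs K 1" and v: "\<And>n. v n \<in> lcs K 1"
    and "K.lcs_coherent u" "K.lcs_coherent v"
    and eq: "\<And>n. lcs K n #>\<^bsub>K\<^esub> (r n \<otimes>\<^bsub>K\<^esub> s n) =
       lcs K n #>\<^bsub>K\<^esub> (commutator K a (u n) \<otimes>\<^bsub>K\<^esub> commutator K b (v n) \<otimes>\<^bsub>K\<^esub> (s n \<otimes>\<^bsub>K\<^esub> r n))"
    using K.commutator_of_limits[of a b r s] aH gen r s unfolding carrier_K by blast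
  have "lcs G n #> (r n \<otimes> s n) =
       lcs G n #> (commutator G a (u n) \<otimes> commutator G b (v n) \<otimes> (s n \<otimes> r n))" for n
  proof (rule lcs_subgroup_rcos_eq[OF H])
    have *: "r n \<in> ?H" "s n \<in> ?H" "u n \<in> ?H" "v n \<in> ?H" using r s u v lcsK by blast+
    have com: "commutator K a (u n) = commutator G a (u n)" "commutator K b (v n) = commutator G b (v n)"
      unfolding K_def using commutator_subgroup[OF H] aH * by auto
    have "commutator K a (u n) \<in> ?H" "commutator K b (v n) \<in> ?H"
      using K.commutator_closed aH * unfolding carrier_K by auto
    then show "r n \<otimes> s n \<in> ?H" "commutator G a (u n) \<otimes> commutator G b (v n) \<otimes> (s n \<otimes> r n) \<in> ?H"
      using * subgroup.m_closed[OF H] by (auto simp: com)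
    show "lcs (G\<lparr>carrier := ?H\<rparr>) n #>\<^bsub>G\<lparr>carrier := ?H\<rparr>\<^esub> (r n \<otimes> s n) = lcs (G\<lparr>carrier := ?H\<rparr>) n
        #>\<^bsub>G\<lparr>carrier := ?H\<rparr>\<^esub> (commutator G a (u n) \<otimes> commutator G b (v n) \<otimes> (s n \<otimes> r n))"
      using eq[of n] unfolding com by (simp add: K_def)
  qed
  moreover have "lcs K 1 \<subseteq> lcs G 1" unfolding K_def by (rule lcs_subgroup_subset[OF H])
  ultimately show ?thesis
    using u v coh cohK[OF r] cohK[OF s] \<open>K.lcs_coherent u\<close> \<open>K.lcs_coherent v\<close> by blast
qed

end

section \<open>Extending affine representations to the completion\<close>

definition completion_degree :: "('a \<Rightarrow> int \<times> 'r fps) \<Rightarrow> (nat \<Rightarrow> 'a set) \<Rightarrow> int" where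
  "completion_degree \<theta> s = fst (\<theta> (SOME f. f \<in> s 1))"

text \<open>
  Elements of \<open>\<gamma>\<^sub>k\<^sub>+\<^sub>2\<close> have second component divisible by \<open>X\<^sup>k\<^sup>+\<^sup>1\<close>, so the coefficient at \<open>k\<close> does not
  depend on the representative of the coset at level \<open>k + 1\<close>.
\<close>

definition completion_coord :: "('a \<Rightarrow> int \<times> 'r fps) \<Rightarrow> (nat \<Rightarrow> 'a set) \<Rightarrow> 'r fps" where
  "completion_coord \<theta> s = Abs_fps (\<lambda>k. fps_nth (snd (\<theta> (SOME f. f \<in> s (Suc k)))) k)"

lemma completionD:
  assumes "s \<in> carrier (pronilpotent_completion G)"
  shows "s n \<in> rcosets\<^bsub>G\<^esub> (lcs G n)" "m \<le> n \<Longrightarrow> s n \<subseteq> s m"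
  using assms lift_Suc_antimono_le[of s m n] by (simp_all add: pronilpotent_completion_def)

lemma (in group) completion_nonempty:
  assumes "s \<in> carrier (pronilpotent_completion G)"
  shows "\<exists>f \<in> carrier G. f \<in> s n"
  using completionD(1)[OF assms, of n] rcos_self[OF _ subgroup_lcs] by (force simp: RCOSETS_def)

lemma (in group) completion_mult_closed:
  assumes s: "s \<in> carrier (pronilpotent_completion G)" and t: "t \<in> carrier (pronilpotent_completion G)"
  shows "s \<otimes>\<^bsub>pronilpotent_completion G\<^esub> t \<in> carrier (pronilpotent_completion G)"
proof -
  have "s n <#> t n \<in> rcosets (lcs G n)" for n
    by (rule normal.setmult_closed[OF normal_lcs completionD(1)[OF s] completionD(1)[OF t]])
  moreover have "s (Suc n) <#> t (Suc n) \<subseteq> s n <#> t n" for n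
    using completionD(2)[OF s, of n "Suc n"] completionD(2)[OF t, of n "Suc n"]
    unfolding set_mult_def by (simp add: subset_iff) blast
  ultimately show ?thesis by (simp add: pronilpotent_completion_def)
qed

text \<open>As \<open>t\<close> is 1 modulo \<open>X\<close>, commutation raises the
  \<open>X\<close>-adic order. This is what makes \<open>\<theta>\<close> extend to the
  completion.\<close>

locale affine_rep = group G for G :: "('a, 'b) monoid_scheme" (structure) +
  fixes \<theta> :: "'a \<Rightarrow> int \<times> 'r::comm_ring_1 fps" and t t' :: "'r fps"
  assumes hom: "\<theta> \<in> hom G (affine_group t t')"
    and inverse: "t * t' = 1" and X_dvd: "fps_X dvd t - 1"
begin

lemma fst_mult: "x \<in> carrier G \<Longrightarrow> y \<in> carrier G \<Longrightarrow> fst (\<theta> (x \<otimes> y)) = fst (\<theta> x) + fst (\<theta> y)"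
  and snd_mult: "x \<in> carrier G \<Longrightarrow> y \<in> carrier G \<Longrightarrow>
    snd (\<theta> (x \<otimes> y)) = snd (\<theta> x) + zpow t t' (fst (\<theta> x)) * snd (\<theta> y)"
  using hom_mult[OF hom, of x y] by (simp_all add: affine_group_def case_prod_unfold)

lemma fst_one: "fst (\<theta> \<one>) = 0" and snd_one: "snd (\<theta> \<one>) = 0"
proof -
  show 1: "fst (\<theta> \<one>) = 0" using fst_mult[of \<one> \<one>] by simp
  show "snd (\<theta> \<one>) = 0" using snd_mult[of \<one> \<one>] 1 by simp
qed

lemma fst_commutator: "x \<in> carrier G \<Longrightarrow> y \<in> carrier G \<Longrightarrow> fst (\<theta> (commutator G x y)) = 0"
  using arg_cong[OF commutator_eq[of x y], of "\<lambda>z. fst (\<theta> z)"] by (simp add: fst_mult)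

lemma snd_commutator:
  assumes "x \<in> carrier G" "y \<in> carrier G"
  shows "snd (\<theta> (commutator G x y)) =
    (zpow t t' (fst (\<theta> x)) - 1) * snd (\<theta> y) - (zpow t t' (fst (\<theta> y)) - 1) * snd (\<theta> x)"
  using arg_cong[OF commutator_eq[of x y], of "\<lambda>z. snd (\<theta> z)"] assms
  by (simp add: snd_mult fst_commutator algebra_simps)

lemma subgroup_X_power: "subgroup {f \<in> carrier G. fst (\<theta> f) = 0 \<and> fps_X ^ n dvd snd (\<theta> f)} G"
proof (rule subgroupI)
  fix f assume f: "f \<in> {f \<in> carrier G. fst (\<theta> f) = 0 \<and> fps_X ^ n dvd snd (\<theta> f)}"
  then have "fst (\<theta> (inv f)) = 0" "snd (\<theta> (inv f)) = - snd (\<theta> f)"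
    using fst_mult[of "inv f" f] snd_mult[of "inv f" f] by (simp_all add: fst_one snd_one eq_neg_iff_add_eq_0)
  then show "inv f \<in> {f \<in> carrier G. fst (\<theta> f) = 0 \<and> fps_X ^ n dvd snd (\<theta> f)}" using f by simp
next
  show "{f \<in> carrier G. fst (\<theta> f) = 0 \<and> fps_X ^ n dvd snd (\<theta> f)} \<noteq> {}"
    by (auto intro: exI[of _ \<one>] simp: fst_one snd_one)
qed (auto simp: fst_mult snd_mult)

lemma X_dvd_zpow: "fps_X dvd zpow t t' n - 1"
  by (rule zpow_minus_1_dvd[OF inverse X_dvd])

text \<open>Commutators have degree 0, and commuting a degree 0 element with anything multiplies its
  second component, up to sign, by a power of \<open>t\<close> minus 1, which is divisible by
  \<open>X\<close>.\<close>

lemma lcs_X_power: "lcs G (Suc n) \<subseteq> {f \<in> carrier G. fst (\<theta> f) = 0 \<and> fps_X ^ Suc n dvd snd (\<theta> f)}"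
proof (induction n)
  case 0
  show ?case unfolding lcs.simps
    by (rule generate_subgroup_incl[OF _ subgroup_X_power])
      (auto simp: commutator_set_eq fst_commutator snd_commutator X_dvd_zpow)
next
  case (Suc n)
  have "fps_X ^ Suc (Suc n) dvd (zpow t t' m - 1) * d" if "fps_X ^ Suc n dvd d" for m d
    using mult_dvd_mono[OF X_dvd_zpow that] by simp
  then show ?case using Suc unfolding lcs.simps(2)[of _ "Suc n"]
    by (intro generate_subgroup_incl[OF _ subgroup_X_power])
      (auto simp: commutator_set_eq fst_commutator snd_commutator simp del: power_Suc)
qed

lemma fps_X_power_dvd_nth: "fps_X ^ n dvd d \<Longrightarrow> k < n \<Longrightarrow> fps_nth d k = 0"
  by (auto simp: dvd_def fps_X_power_mult_nth)

lemma rcoset_eq: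
  assumes "f \<in> lcs G n #> x" "x \<in> carrier G" "n \<ge> 1"
  shows "fst (\<theta> f) = fst (\<theta> x)" "k < n \<Longrightarrow> fps_nth (snd (\<theta> f)) k = fps_nth (snd (\<theta> x)) k"
proof -
  obtain l where l: "l \<in> lcs G n" "f = l \<otimes> x" using assms(1) by (auto simp: r_coset_def)
  obtain m where n: "n = Suc m" using assms(3) by (cases n) auto
  have "l \<in> carrier G" "fst (\<theta> l) = 0" "fps_X ^ n dvd snd (\<theta> l)"
    using l(1) lcs_X_power[of m] by (auto simp: n)
  then show "fst (\<theta> f) = fst (\<theta> x)" "k < n \<Longrightarrow> fps_nth (snd (\<theta> f)) k = fps_nth (snd (\<theta> x)) k"
    using l(2) assms(2) fps_X_power_dvd_nth by (auto simp: fst_mult snd_mult)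
qed

lemma same_rcoset:
  assumes s: "s \<in> carrier (pronilpotent_completion G)" and f: "f \<in> s n" "g \<in> s n" "n \<ge> 1"
  shows "fst (\<theta> f) = fst (\<theta> g)" "k < n \<Longrightarrow> fps_nth (snd (\<theta> f)) k = fps_nth (snd (\<theta> g)) k"
proof -
  obtain x where x: "x \<in> carrier G" "s n = lcs G n #> x"
    using completionD(1)[OF s, of n] by (auto simp: RCOSETS_def)
  show "fst (\<theta> f) = fst (\<theta> g)" "k < n \<Longrightarrow> fps_nth (snd (\<theta> f)) k = fps_nth (snd (\<theta> g)) k"
    using rcoset_eq[of f n x] rcoset_eq[of g n x] f x by auto
qed

text \<open>Elements of \<open>lcs G 1\<close> have degree 0, so the degree is constant on the coset
  \<open>s 1\<close>, which contains all later \<open>s n\<close>.\<close>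

lemma completion_degree_eq:
  assumes s: "s \<in> carrier (pronilpotent_completion G)" and f: "f \<in> s n" "n \<ge> 1"
  shows "completion_degree \<theta> s = fst (\<theta> f)"
proof -
  have "f \<in> s 1" using completionD(2)[OF s f(2)] f(1) by blast
  then have "(SOME f. f \<in> s 1) \<in> s 1" by (rule someI)
  then show ?thesis unfolding completion_degree_def
    using same_rcoset(1)[OF s _ \<open>f \<in> s 1\<close>] by simp
qed

lemma completion_coord_nth:
  assumes s: "s \<in> carrier (pronilpotent_completion G)" and f: "f \<in> s n" "k < n"
  shows "fps_nth (completion_coord \<theta> s) k = fps_nth (snd (\<theta> f)) k"
proof -
  have "f \<in> s (Suc k)" using completionD(2)[OF s, of "Suc k" n] f by auto
  then have "(SOME f. f \<in> s (Suc k)) \<in> s (Suc k)" by (rule someI)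
  then show ?thesis unfolding completion_coord_def
    using same_rcoset(2)[OF s _ \<open>f \<in> s (Suc k)\<close>] by simp
qed

lemma completion_degree_mult:
  assumes s: "s \<in> carrier (pronilpotent_completion G)" and u: "u \<in> carrier (pronilpotent_completion G)"
  shows "completion_degree \<theta> (s \<otimes>\<^bsub>pronilpotent_completion G\<^esub> u) = completion_degree \<theta> s + completion_degree \<theta> u"
proof -
  obtain f g where fg: "f \<in> carrier G" "f \<in> s 1" "g \<in> carrier G" "g \<in> u 1"
    using completion_nonempty[OF s, of 1] completion_nonempty[OF u, of 1] by blast
  then have "f \<otimes> g \<in> (s \<otimes>\<^bsub>pronilpotent_completion G\<^esub> u) 1"
    unfolding pronilpotent_completion_def set_mult_def by simp blast
  then show ?thesis
    using completion_degree_eq[OF completion_mult_closed[OF s u], of "f \<otimes> g" 1]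
      completion_degree_eq[OF s, of f 1] completion_degree_eq[OF u, of g 1] fg by (simp add: fst_mult)
qed

lemma completion_coord_mult:
  assumes s: "s \<in> carrier (pronilpotent_completion G)" and u: "u \<in> carrier (pronilpotent_completion G)"
  shows "completion_coord \<theta> (s \<otimes>\<^bsub>pronilpotent_completion G\<^esub> u) =
    completion_coord \<theta> s + zpow t t' (completion_degree \<theta> s) * completion_coord \<theta> u"
proof (rule fps_ext)
  fix k
  obtain f g where fg: "f \<in> carrier G" "f \<in> s (Suc k)" "g \<in> carrier G" "g \<in> u (Suc k)"
    using completion_nonempty[OF s, of "Suc k"] completion_nonempty[OF u, of "Suc k"] by blast
  then have "f \<otimes> g \<in> (s \<otimes>\<^bsub>pronilpotent_completion G\<^esub> u) (Suc k)"
    unfolding pronilpotent_completion_def set_mult_def by simp blast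
  then have "fps_nth (completion_coord \<theta> (s \<otimes>\<^bsub>pronilpotent_completion G\<^esub> u)) k =
      fps_nth (snd (\<theta> f)) k + fps_nth (zpow t t' (fst (\<theta> f)) * snd (\<theta> g)) k"
    using completion_coord_nth[OF completion_mult_closed[OF s u]] fg by (simp add: snd_mult)
  \<comment> \<open>Coefficient \<open>k\<close> of a product involves only coefficients of index at
    most \<open>k\<close>, and up to there \<open>g\<close> determines the coordinate of
    \<open>u\<close>.\<close>
  also have "fps_nth (zpow t t' (fst (\<theta> f)) * snd (\<theta> g)) k =
     fps_nth (zpow t t' (completion_degree \<theta> s) * completion_coord \<theta> u) k"
    using completion_degree_eq[OF s fg(2)] completion_coord_nth[OF u fg(4)] by (simp add: fps_mult_nth)
  finally show "fps_nth (completion_coord \<theta> (s \<otimes>\<^bsub>pronilpotent_completion G\<^esub> u)) k =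
    fps_nth (completion_coord \<theta> s + zpow t t' (completion_degree \<theta> s) * completion_coord \<theta> u) k"
    using completion_coord_nth[OF s fg(2)] by simp
qed

lemma completion_degree_lim:
  assumes "lcs_coherent g"
  shows "completion_degree \<theta> (completion_lim g) = fst (\<theta> (g 1))"
  using completion_degree_eq[OF completion_lim_closed[OF assms], of "g 1" 1]
    rcos_self[OF lcs_coherentD(1)[OF assms] subgroup_lcs] by (simp add: completion_lim_def)

lemma completion_coord_lim_nth:
  assumes "lcs_coherent g"
  shows "fps_nth (completion_coord \<theta> (completion_lim g)) k = fps_nth (snd (\<theta> (g (Suc k)))) k"
  using completion_coord_nth[OF completion_lim_closed[OF assms], of "g (Suc k)" "Suc k"]
    rcos_self[OF lcs_coherentD(1)[OF assms] subgroup_lcs] by (simp add: completion_lim_def)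

lemma completion_coord_const:
  "x \<in> carrier G \<Longrightarrow> completion_coord \<theta> (completion_lim (\<lambda>_. x)) = snd (\<theta> x)"
  by (rule fps_ext) (simp add: completion_coord_lim_nth lcs_coherent_const)

end

section \<open>Products of iterated commutators\<close>

context group
begin

text \<open>In an affine representation sending \<open>a\<close> to \<open>(1, 0)\<close> and
  \<open>b\<close> to \<open>(0, 1)\<close>, these elements realise the powers of
  \<open>t - 1\<close>.\<close>

primrec engel :: "'a \<Rightarrow> 'a \<Rightarrow> nat \<Rightarrow> 'a" where
  "engel a b 0 = b"
| "engel a b (Suc n) = commutator G a (engel a b n)"

text \<open>Partial products of an infinite product with factors selected by
  \<open>\<epsilon>\<close>, giving a family of limits indexed by an uncountable set. The factors
  begin with a proper commutator, so that all products lie in \<open>lcs G 1\<close>.\<close>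

primrec engel_prod :: "'a \<Rightarrow> 'a \<Rightarrow> (nat \<Rightarrow> bool) \<Rightarrow> nat \<Rightarrow> 'a" where
  "engel_prod a b \<epsilon> 0 = \<one>"
| "engel_prod a b \<epsilon> (Suc n) = engel_prod a b \<epsilon> n \<otimes> (if \<epsilon> n then engel a b (Suc n) else \<one>)"

lemma engel_in_lcs:
  "a \<in> carrier G \<Longrightarrow> b \<in> carrier G \<Longrightarrow> engel a b n \<in> lcs G n"
  by (induction n) (auto intro: commutator_in_lcs)

lemma engel_closed: "a \<in> carrier G \<Longrightarrow> b \<in> carrier G \<Longrightarrow> engel a b n \<in> carrier G"
  using engel_in_lcs lcs_closed by blast

lemma engel_prod_in_lcs:
  assumes "a \<in> carrier G" "b \<in> carrier G"
  shows "engel_prod a b \<epsilon> n \<in> lcs G 1"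
proof (induction n)
  case 0
  then show ?case using subgroup.one_closed[OF subgroup_lcs] by simp
next
  case (Suc n)
  then show ?case
    using engel_in_lcs[OF assms, of "Suc n"] lcs_antimono[of 1 "Suc n"]
      subgroup.m_closed[OF subgroup_lcs[of 1]] subgroup.one_closed[OF subgroup_lcs[of 1]] by auto
qed

lemma engel_prod_coherent:
  assumes "a \<in> carrier G" "b \<in> carrier G"
  shows "lcs G (Suc n) #> engel_prod a b \<epsilon> (Suc n) = lcs G (Suc n) #> engel_prod a b \<epsilon> n"
  using engel_in_lcs[OF assms, of "Suc n"] lcs_closed[OF engel_prod_in_lcs[OF assms]]
  by (simp add: lcs_rcos_mult_absorb)

text \<open>Hence the products may be placed in the lower central series of the subgroup generated
  by \<open>a\<close> and \<open>b\<close>, as \<open>completion_commutator_relation\<close>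
  demands.\<close>

lemma engel_subgroup:
  assumes H: "subgroup H G" and ab: "a \<in> H" "b \<in> H"
  shows "group.engel (G\<lparr>carrier := H\<rparr>) a b n = engel a b n"
    "group.engel_prod (G\<lparr>carrier := H\<rparr>) a b \<epsilon> n = engel_prod a b \<epsilon> n"
proof -
  interpret K: group "G\<lparr>carrier := H\<rparr>" by (rule subgroup_imp_group[OF H])
  have mem: "K.engel a b n \<in> H" for n using K.engel_closed[of a b n] ab by simp
  have com: "commutator (G\<lparr>carrier := H\<rparr>) a (K.engel a b n) = commutator G a (K.engel a b n)" for n
    using commutator_subgroup[OF H ab(1) mem] .
  show eq: "K.engel a b n = engel a b n" for n
  proof (induction n)
    case (Suc n)
    then show ?case using com[of n] by simp
  qed simp
  show "K.engel_prod a b \<epsilon> n = engel_prod a b \<epsilon> n"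
    by (induction n) (simp_all add: com, simp_all add: eq)
qed

end

context affine_rep
begin

lemma theta_engel:
  assumes "a \<in> carrier G" "b \<in> carrier G" and "\<theta> a = (1, 0)" "\<theta> b = (0, 1)"
  shows "\<theta> (engel a b n) = (0, (t - 1) ^ n)"
proof (induction n)
  case (Suc n)
  then show ?case using assms(1,3) engel_closed[OF assms(1,2)]
    by (simp add: prod_eq_iff fst_commutator snd_commutator zpow_def)
qed (simp add: assms)

lemma theta_engel_prod:
  assumes "a \<in> carrier G" "b \<in> carrier G" and "\<theta> a = (1, 0)" "\<theta> b = (0, 1)"
  shows "\<theta> (engel_prod a b \<epsilon> n) = (0, \<Sum>j<n. of_bool (\<epsilon> j) * (t - 1) ^ Suc j)"
proof (induction n)
  case 0
  then show ?case by (simp add: prod_eq_iff fst_one snd_one)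
next
  case (Suc n)
  have "engel_prod a b \<epsilon> n \<in> carrier G" using engel_prod_in_lcs[OF assms(1,2)] lcs_closed by blast
  then show ?case using Suc engel_closed[OF assms(1,2), of "Suc n"] theta_engel[OF assms, of "Suc n"]
    by (simp add: prod_eq_iff fst_mult snd_mult fst_one snd_one del: engel.simps)
qed

end

section \<open>Bar cycles and cocycles\<close>

text \<open>Evaluation of a cochain on a chain. It is meant for finite support, as a sum over an
  infinite set is 0 by convention.\<close>

definition pairing :: "('c \<Rightarrow> int) \<Rightarrow> ('c \<Rightarrow> int) \<Rightarrow> int" where
  "pairing c f = (\<Sum>z | c z \<noteq> 0. c z * f z)"

lemma pairing_eq_sum:
  "finite S \<Longrightarrow> {z. c z \<noteq> 0} \<subseteq> S \<Longrightarrow> pairing c f = (\<Sum>z\<in>S. c z * f z)"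
  unfolding pairing_def by (intro sum.mono_neutral_left) auto

lemma finite_support_diff:
  fixes c c' :: "'c \<Rightarrow> int"
  assumes "finite {z. c z \<noteq> 0}" "finite {z. c' z \<noteq> 0}"
  shows "finite {z. c z - c' z \<noteq> 0}"
  by (rule finite_subset[OF _ finite_UnI[OF assms]]) auto

lemma pairing_diff:
  assumes "finite {z. c z \<noteq> 0}" "finite {z. c' z \<noteq> 0}"
  shows "pairing (\<lambda>z. c z - c' z) f = pairing c f - pairing c' f"
proof -
  let ?S = "{z. c z \<noteq> 0} \<union> {z. c' z \<noteq> 0}"
  have S: "finite ?S" using assms by simp
  have "pairing (\<lambda>z. c z - c' z) f = (\<Sum>z\<in>?S. (c z - c' z) * f z)" by (rule pairing_eq_sum[OF S]) auto
  also have "\<dots> = (\<Sum>z\<in>?S. c z * f z) - (\<Sum>z\<in>?S. c' z * f z)"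
    by (simp only: left_diff_distrib sum_subtractf)
  also have "(\<Sum>z\<in>?S. c z * f z) = pairing c f" by (rule pairing_eq_sum[OF S, symmetric]) auto
  also have "(\<Sum>z\<in>?S. c' z * f z) = pairing c' f" by (rule pairing_eq_sum[OF S, symmetric]) auto
  finally show ?thesis .
qed

lemma finite_support_single: "finite {z. of_bool (z = y) \<noteq> (0 :: int)}"
  by simp

lemma pairing_single: "pairing (\<lambda>z. of_bool (z = y)) f = f y"
  using pairing_eq_sum[of "{y}" "\<lambda>z. of_bool (z = y)" f] by auto

text \<open>With the boundary written as a pairing, boundaries of explicit chains follow from the
  same evaluation rules as values of cocycles.\<close>

lemma bd2_eq_pairing: "bd2 G c x = pairing c (\<lambda>(g, h).
    of_bool (h = x) - of_bool (g \<otimes>\<^bsub>G\<^esub> h = x) + of_bool (g = x))"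
  unfolding bd2_def pairing_def by (intro sum.cong) (auto simp: of_bool_def)

definition is_cocycle_mod :: "int \<Rightarrow> ('a, 'b) monoid_scheme \<Rightarrow> ('a \<times> 'a \<Rightarrow> int) \<Rightarrow> bool" where
  "is_cocycle_mod m G f \<longleftrightarrow> (\<forall>g \<in> carrier G. \<forall>h \<in> carrier G. \<forall>k \<in> carrier G.
     m dvd f (h, k) - f (g \<otimes>\<^bsub>G\<^esub> h, k) + f (g, h \<otimes>\<^bsub>G\<^esub> k) - f (g, h))"

text \<open>Boundary and coboundary are adjoint under the pairing, by interchanging two finite
  sums.\<close>

lemma finite_support_bd3:
  assumes "d \<in> chains3 G"
  shows "finite {y. bd3 G d y \<noteq> 0}"
    and "pairing (bd3 G d) f = (\<Sum>(g, h, k) | d (g, h, k) \<noteq> 0. d (g, h, k) *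
      (f (h, k) - f (g \<otimes>\<^bsub>G\<^esub> h, k) + f (g, h \<otimes>\<^bsub>G\<^esub> k) - f (g, h)))"
proof -
  let ?S = "{z. d z \<noteq> 0}"
  have S: "finite ?S" using assms by (simp add: chains3_def)
  \<comment> \<open>A finite set containing all faces of the support of \<open>d\<close>, and hence
    the support of its boundary.\<close>
  define T where "T = (\<Union>(g, h, k) \<in> ?S. {(h, k), (g \<otimes>\<^bsub>G\<^esub> h, k), (g, h \<otimes>\<^bsub>G\<^esub> k), (g, h)})"
  have T: "finite T" unfolding T_def using S by auto
  have T_mem: "(h, k) \<in> T" "(g \<otimes>\<^bsub>G\<^esub> h, k) \<in> T" "(g, h \<otimes>\<^bsub>G\<^esub> k) \<in> T" "(g, h) \<in> T"
    if "(g, h, k) \<in> ?S" for g h k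
    using that unfolding T_def by auto
  have bd: "bd3 G d y = (\<Sum>(g, h, k) \<in> ?S. d (g, h, k) * (of_bool ((h, k) = y) -
      of_bool ((g \<otimes>\<^bsub>G\<^esub> h, k) = y) + of_bool ((g, h \<otimes>\<^bsub>G\<^esub> k) = y) - of_bool ((g, h) = y)))" for y
    unfolding bd3_def by (intro sum.cong) (auto simp: of_bool_def)
  have sub: "{y. bd3 G d y \<noteq> 0} \<subseteq> T"
  proof
    fix y assume "y \<in> {y. bd3 G d y \<noteq> 0}"
    then have "bd3 G d y \<noteq> 0" by simp
    then obtain z where "z \<in> ?S" "(case z of (g, h, k) \<Rightarrow> d (g, h, k) * (of_bool ((h, k) = y) -
      of_bool ((g \<otimes>\<^bsub>G\<^esub> h, k) = y) + of_bool ((g, h \<otimes>\<^bsub>G\<^esub> k) = y) - of_bool ((g, h) = y))) \<noteq> 0"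
      unfolding bd using sum.not_neutral_contains_not_neutral by blast
    then show "y \<in> T" using T_mem by (cases z) (auto split: if_splits simp: of_bool_def)
  qed
  then show "finite {y. bd3 G d y \<noteq> 0}" using T finite_subset by blast
  have single: "(\<Sum>y\<in>T. of_bool (y0 = y) * f y) = f y0" if "y0 \<in> T" for y0
  proof -
    have "(\<Sum>y\<in>T. of_bool (y0 = y) * f y) = (\<Sum>y\<in>T. if y0 = y then f y else 0)"
      by (intro sum.cong) auto
    then show ?thesis using T that by simp
  qed
  have "pairing (bd3 G d) f = (\<Sum>y\<in>T. bd3 G d y * f y)" by (rule pairing_eq_sum[OF T sub])
  also have "\<dots> = (\<Sum>z\<in>?S. \<Sum>y\<in>T. (case z of (g, h, k) \<Rightarrow> d (g, h, k) * (of_bool ((h, k) = y) -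
      of_bool ((g \<otimes>\<^bsub>G\<^esub> h, k) = y) + of_bool ((g, h \<otimes>\<^bsub>G\<^esub> k) = y) - of_bool ((g, h) = y))) * f y)"
    unfolding bd sum_distrib_right by (rule sum.swap)
  also have "\<dots> = (\<Sum>(g, h, k) \<in> ?S. d (g, h, k) *
      (f (h, k) - f (g \<otimes>\<^bsub>G\<^esub> h, k) + f (g, h \<otimes>\<^bsub>G\<^esub> k) - f (g, h)))"
  proof (rule sum.cong[OF refl])
    fix z assume "z \<in> ?S"
    then obtain g h k where z: "z = (g, h, k)" "(g, h, k) \<in> ?S" by (cases z) auto
    have "(\<Sum>y\<in>T. (case z of (g, h, k) \<Rightarrow> d (g, h, k) * (of_bool ((h, k) = y) -
      of_bool ((g \<otimes>\<^bsub>G\<^esub> h, k) = y) + of_bool ((g, h \<otimes>\<^bsub>G\<^esub> k) = y) - of_bool ((g, h) = y))) * f y) =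
      d z * ((\<Sum>y\<in>T. of_bool ((h, k) = y) * f y) - (\<Sum>y\<in>T. of_bool ((g \<otimes>\<^bsub>G\<^esub> h, k) = y) * f y) +
      (\<Sum>y\<in>T. of_bool ((g, h \<otimes>\<^bsub>G\<^esub> k) = y) * f y) - (\<Sum>y\<in>T. of_bool ((g, h) = y) * f y))"
      unfolding z(1) prod.case sum.distrib[symmetric] sum_subtractf[symmetric] sum_distrib_left
      by (intro sum.cong refl) (simp only: mult.assoc left_diff_distrib distrib_right)
    then show "(\<Sum>y\<in>T. (case z of (g, h, k) \<Rightarrow> d (g, h, k) * (of_bool ((h, k) = y) -
      of_bool ((g \<otimes>\<^bsub>G\<^esub> h, k) = y) + of_bool ((g, h \<otimes>\<^bsub>G\<^esub> k) = y) - of_bool ((g, h) = y))) * f y) =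
      (case z of (g, h, k) \<Rightarrow> d (g, h, k) *
      (f (h, k) - f (g \<otimes>\<^bsub>G\<^esub> h, k) + f (g, h \<otimes>\<^bsub>G\<^esub> k) - f (g, h)))"
      unfolding single[OF T_mem(1)[OF z(2)]] single[OF T_mem(2)[OF z(2)]] single[OF T_mem(3)[OF z(2)]]
        single[OF T_mem(4)[OF z(2)]] by (simp add: z(1))
  qed
  also have "?S = {(g, h, k). d (g, h, k) \<noteq> 0}" by auto
  finally show "pairing (bd3 G d) f = (\<Sum>(g, h, k) | d (g, h, k) \<noteq> 0. d (g, h, k) *
      (f (h, k) - f (g \<otimes>\<^bsub>G\<^esub> h, k) + f (g, h \<otimes>\<^bsub>G\<^esub> k) - f (g, h)))" .
qed

lemma pairing_bd3:
  assumes d: "d \<in> chains3 G" and f: "is_cocycle_mod m G f"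
  shows "m dvd pairing (bd3 G d) f"
  unfolding finite_support_bd3(2)[OF d]
proof (rule dvd_sum, clarify)
  fix g h k assume "d (g, h, k) \<noteq> 0"
  then have "g \<in> carrier G \<and> h \<in> carrier G \<and> k \<in> carrier G" using d by (auto simp: chains3_def)
  then show "m dvd d (g, h, k) * (f (h, k) - f (g \<otimes>\<^bsub>G\<^esub> h, k) + f (g, h \<otimes>\<^bsub>G\<^esub> k) - f (g, h))"
    using f by (intro dvd_mult) (auto simp: is_cocycle_mod_def)
qed

text \<open>A cocycle modulo \<open>m\<close> is constant modulo \<open>m\<close> on homology
  classes. Two moduli are kept apart so that \<open>n = m\<close> covers coefficients modulo
  \<open>m\<close> and \<open>n = 0\<close> integral homology.\<close>

lemma homologous2_pairing:
  assumes c: "c \<in> chains2 G" "c' \<in> chains2 G" and hom: "homologous2 n G c c'"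
    and f: "is_cocycle_mod m G f" and "m dvd n"
  shows "m dvd pairing c f - pairing c' f"
proof -
  obtain d where d: "d \<in> chains3 G" and dvd: "\<And>y. n dvd c y - c' y - bd3 G d y"
    using hom by (auto simp: homologous2_def)
  have fin: "finite {z. c z \<noteq> 0}" "finite {z. c' z \<noteq> 0}" "finite {z. bd3 G d z \<noteq> 0}"
    using c finite_support_bd3(1)[OF d] by (auto simp: chains2_def)
  have "m dvd pairing (\<lambda>y. c y - c' y - bd3 G d y) f"
    unfolding pairing_def using dvd dvd_trans[OF \<open>m dvd n\<close>] by (intro dvd_sum dvd_mult2) auto
  also have "pairing (\<lambda>y. c y - c' y - bd3 G d y) f = pairing c f - pairing c' f - pairing (bd3 G d) f"
    using pairing_diff[OF finite_support_diff[OF fin(1,2)] fin(3)] pairing_diff[OF fin(1,2)] by simp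
  finally show ?thesis using pairing_bd3[OF d f] by (metis dvd_diff_left_iff)
qed

text \<open>If \<open>x y = z (y x)\<close>, then the boundary of this chain is \<open>- [z]\<close>.\<close>

definition commutator_chain :: "('a, 'b) monoid_scheme \<Rightarrow> 'a \<Rightarrow> 'a \<Rightarrow> 'a \<Rightarrow> 'a \<times> 'a \<Rightarrow> int" where
  "commutator_chain G x y z q = of_bool (q = (x, y)) - of_bool (q = (y, x)) - of_bool (q = (z, y \<otimes>\<^bsub>G\<^esub> x))"

lemma finite_support_commutator_chain: "finite {q. commutator_chain G x y z q \<noteq> 0}"
  unfolding commutator_chain_def by (intro finite_support_diff finite_support_single)

lemma pairing_commutator_chain:
  "pairing (commutator_chain G x y z) f = f (x, y) - f (y, x) - f (z, y \<otimes>\<^bsub>G\<^esub> x)"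
  unfolding commutator_chain_def
  by (subst pairing_diff, (intro finite_support_diff finite_support_single)+)+
    (simp only: pairing_single)

text \<open>The cycle of a relation \<open>[r, s] = [a, u] [b, v]\<close> with
  \<open>x = [a, u]\<close> and \<open>y = [b, v]\<close>: the three commutator chains contribute
  the boundary \<open>- [x y] + [x] + [y]\<close>, which the term at \<open>(x, y)\<close>
  cancels.\<close>

definition double_commutator_chain ::
    "('a, 'b) monoid_scheme \<Rightarrow> 'a \<times> 'a \<Rightarrow> 'a \<times> 'a \<Rightarrow> 'a \<times> 'a \<Rightarrow> 'a \<Rightarrow> 'a \<Rightarrow> 'a \<times> 'a \<Rightarrow> int" where
  "double_commutator_chain G = (\<lambda>(r, s) (a, u) (b, v) x y q.
     commutator_chain G r s (x \<otimes>\<^bsub>G\<^esub> y) q - commutator_chain G a u x q - commutator_chain G b v y q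
       - of_bool (q = (x, y)))"

lemma pairing_double_commutator_chain:
  "pairing (double_commutator_chain G (r, s) (a, u) (b, v) x y) f =
     pairing (commutator_chain G r s (x \<otimes>\<^bsub>G\<^esub> y)) f - pairing (commutator_chain G a u x) f
       - pairing (commutator_chain G b v y) f - f (x, y)"
  unfolding double_commutator_chain_def prod.case
  by (subst pairing_diff,
      (intro finite_support_diff finite_support_single finite_support_commutator_chain)+)+
    (simp only: pairing_single)

lemma double_commutator_chain_cycle:
  assumes closed: "\<And>g h. g \<in> carrier G \<Longrightarrow> h \<in> carrier G \<Longrightarrow> g \<otimes>\<^bsub>G\<^esub> h \<in> carrier G"
    and carrier: "{r, s, a, u, b, v, x, y} \<subseteq> carrier G"
    and rel: "r \<otimes>\<^bsub>G\<^esub> s = (x \<otimes>\<^bsub>G\<^esub> y) \<otimes>\<^bsub>G\<^esub> (s \<otimes>\<^bsub>G\<^esub> r)"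
      "a \<otimes>\<^bsub>G\<^esub> u = x \<otimes>\<^bsub>G\<^esub> (u \<otimes>\<^bsub>G\<^esub> a)" "b \<otimes>\<^bsub>G\<^esub> v = y \<otimes>\<^bsub>G\<^esub> (v \<otimes>\<^bsub>G\<^esub> b)"
  shows "double_commutator_chain G (r, s) (a, u) (b, v) x y \<in> cycles2 m G"
proof -
  let ?c = "double_commutator_chain G (r, s) (a, u) (b, v) x y"
  have "finite {q. ?c q \<noteq> 0}"
    unfolding double_commutator_chain_def prod.case
    by (intro finite_support_diff finite_support_single finite_support_commutator_chain)
  moreover have "{q. ?c q \<noteq> 0} \<subseteq> carrier G \<times> carrier G"
  proof (rule subsetI, rule ccontr)
    fix q assume q: "q \<in> {q. ?c q \<noteq> 0}" "q \<notin> carrier G \<times> carrier G"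
    have "{(r, s), (s, r), (x \<otimes>\<^bsub>G\<^esub> y, s \<otimes>\<^bsub>G\<^esub> r), (a, u), (u, a), (x, u \<otimes>\<^bsub>G\<^esub> a),
      (b, v), (v, b), (y, v \<otimes>\<^bsub>G\<^esub> b), (x, y)} \<subseteq> carrier G \<times> carrier G"
      using carrier closed by simp
    then have "q \<notin> {(r, s), (s, r), (x \<otimes>\<^bsub>G\<^esub> y, s \<otimes>\<^bsub>G\<^esub> r), (a, u), (u, a), (x, u \<otimes>\<^bsub>G\<^esub> a),
      (b, v), (v, b), (y, v \<otimes>\<^bsub>G\<^esub> b), (x, y)}" using q(2) by blast
    then have "?c q = 0" by (simp add: double_commutator_chain_def commutator_chain_def)
    then show False using q(1) by simp
  qed
  ultimately have "?c \<in> chains2 G" unfolding chains2_def by blast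
  moreover have "bd2 G ?c w = 0" for w
    unfolding bd2_eq_pairing pairing_double_commutator_chain pairing_commutator_chain prod.case rel by simp
  ultimately show ?thesis by (simp add: cycles2_def)
qed

section \<open>Detecting the homology classes\<close>

lemma uncountable_UNIV_nat_bool: "uncountable (UNIV :: (nat \<Rightarrow> bool) set)"
proof
  assume "countable (UNIV :: (nat \<Rightarrow> bool) set)"
  then obtain f :: "nat \<Rightarrow> nat \<Rightarrow> bool" where "range f = UNIV"
    by (metis UNIV_not_empty range_from_nat_into)
  then obtain n where "f n = (\<lambda>m. \<not> f m m)" by (metis UNIV_I imageE)
  then show False by (metis (full_types))
qed

text \<open>Distinct arguments have incongruent values, so choosing a congruent element of
  \<open>S\<close> is injective.\<close>

lemma countable_congruent:
  fixes q :: "'r::comm_ring_1"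
  assumes "countable S" and sep: "\<And>x y. x \<noteq> y \<Longrightarrow> \<not> q dvd f x - f y"
  shows "countable {x. \<exists>k \<in> S. q dvd f x - k}"
proof -
  define g where "g x = (SOME k. k \<in> S \<and> q dvd f x - k)" for x
  have g: "g x \<in> S" "q dvd f x - g x" if "\<exists>k \<in> S. q dvd f x - k" for x
    using someI_ex[of "\<lambda>k. k \<in> S \<and> q dvd f x - k"] that unfolding g_def by blast+
  have "inj_on g {x. \<exists>k \<in> S. q dvd f x - k}"
  proof (rule inj_onI, rule ccontr)
    fix x y assume x: "x \<in> {x. \<exists>k \<in> S. q dvd f x - k}" and y: "y \<in> {x. \<exists>k \<in> S. q dvd f x - k}"
      and eq: "g x = g y" and "x \<noteq> y"
    have "q dvd (f x - g x) - (f y - g y)" using dvd_diff[OF g(2) g(2), of x y] x y by simp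
    then show False using sep[OF \<open>x \<noteq> y\<close>] eq by simp
  qed
  moreover have "countable (g ` {x. \<exists>k \<in> S. q dvd f x - k})"
    by (rule countable_subset[OF _ \<open>countable S\<close>]) (use g in auto)
  ultimately show ?thesis using countable_image_inj_on by blast
qed

lemma (in subfield_modulo) linear_modulo_diff:
  assumes "linear_modulo \<phi>"
  shows "q dvd \<phi> (a - b) - (\<phi> a - \<phi> b)"
proof -
  have "q dvd \<phi> (a - b + b) - (\<phi> (a - b) + \<phi> b)" using assms unfolding linear_modulo_def by blast
  then have "q dvd - (\<phi> a - (\<phi> (a - b) + \<phi> b))" by (simp only: dvd_minus_iff) simp
  then show ?thesis by (simp add: algebra_simps)
qed

lemma (in subfield_modulo) linear_modulo_zero:
  assumes "linear_modulo \<phi>"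
  shows "q dvd \<phi> 0"
  using linear_modulo_diff[OF assms, of 0 0] by simp

lemma (in subfield_modulo) bilinear_cocycle_identity:
  assumes \<phi>: "linear_modulo \<phi>" and \<psi>: "linear_modulo \<psi>" and c: "c \<in> K" "c' \<in> K" "c * c' = 1"
  shows "q dvd \<phi> x * \<psi> y - \<phi> (w + c * x) * \<psi> (c' * y) + \<phi> w * \<psi> (z + c' * y) - \<phi> w * \<psi> z"
proof -
  obtain e1 where e1: "\<phi> (w + c * x) - (\<phi> w + \<phi> (c * x)) = q * e1"
    using \<phi> unfolding linear_modulo_def by (meson dvdE)
  obtain e2 where e2: "\<phi> (c * x) - c * \<phi> x = q * e2"
    using \<phi> c(1) unfolding linear_modulo_def by (meson dvdE)
  obtain e3 where e3: "\<psi> (z + c' * y) - (\<psi> z + \<psi> (c' * y)) = q * e3"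
    using \<psi> unfolding linear_modulo_def by (meson dvdE)
  obtain e4 where e4: "\<psi> (c' * y) - c' * \<psi> y = q * e4"
    using \<psi> c(2) unfolding linear_modulo_def by (meson dvdE)
  have 1: "\<phi> (w + c * x) = \<phi> w + c * \<phi> x + q * (e1 + e2)" using e1 e2 by (simp add: algebra_simps)
  have 2: "\<psi> (z + c' * y) = \<psi> z + \<psi> (c' * y) + q * e3" using e3 by (simp add: algebra_simps)
  have 3: "c * \<phi> x * \<psi> (c' * y) = \<phi> x * \<psi> y + q * (c * \<phi> x * e4)"
  proof -
    have "\<psi> (c' * y) = c' * \<psi> y + q * e4" using e4 by (simp add: algebra_simps)
    then have "c * \<phi> x * \<psi> (c' * y) = (c * c') * (\<phi> x * \<psi> y) + q * (c * \<phi> x * e4)"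
      by (simp add: algebra_simps)
    then show ?thesis using c(3) by simp
  qed
  have "\<phi> x * \<psi> y - \<phi> (w + c * x) * \<psi> (c' * y) + \<phi> w * \<psi> (z + c' * y) - \<phi> w * \<psi> z
    = \<phi> x * \<psi> y - c * \<phi> x * \<psi> (c' * y) - q * (e1 + e2) * \<psi> (c' * y) + \<phi> w * (q * e3)"
    unfolding 1 2 by (simp add: algebra_simps)
  also have "\<dots> = q * (- (c * \<phi> x * e4) - (e1 + e2) * \<psi> (c' * y) + \<phi> w * e3)"
    unfolding 3 by (simp add: algebra_simps)
  finally show ?thesis by simp
qed

context affine_rep
begin

lemma completion_coord_engel_prod_nth:
  assumes "a \<in> carrier G" "b \<in> carrier G" and "\<theta> a = (1, 0)" "\<theta> b = (0, 1)"
  shows "fps_nth (completion_coord \<theta> (completion_lim (engel_prod a b \<epsilon>))) k =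
    (\<Sum>j<k. of_bool (\<epsilon> j) * fps_nth ((t - 1) ^ Suc j) k)"
proof -
  have coh: "lcs_coherent (engel_prod a b \<epsilon>)"
    unfolding lcs_coherent_def
    using lcs_closed[OF engel_prod_in_lcs[OF assms(1,2)]]
      lcs_rcos_eq_mono[OF le_SucI[OF order_refl] _ _ engel_prod_coherent[OF assms(1,2)]] by blast
  \<comment> \<open>Level \<open>Suc k\<close> also contains the factor with index \<open>k\<close>,
    but that one starts only in degree \<open>k + 1\<close>.\<close>
  have 0: "fps_nth ((t - 1) ^ Suc k) k = 0"
    using fps_X_power_dvd_nth[of "Suc k" "(t - 1) ^ Suc k" k] dvd_power_same[OF X_dvd] by blast
  have of_bool: "fps_nth (of_bool P * x) k = of_bool P * fps_nth x k" for P and x :: "'r fps" by (cases P) simp_all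
  have "fps_nth (completion_coord \<theta> (completion_lim (engel_prod a b \<epsilon>))) k =
      (\<Sum>j<Suc k. of_bool (\<epsilon> j) * fps_nth ((t - 1) ^ Suc j) k)"
    unfolding completion_coord_lim_nth[OF coh] theta_engel_prod[OF assms] snd_conv fps_sum_nth of_bool ..
  then show ?thesis using 0 by simp
qed

end

text \<open>Coordinates add up in products of degree 0 elements, so comparing both sides of the
  relations for \<open>b, v\<close> and \<open>r, s\<close> kills the coordinates of
  \<open>y\<close> and of the product of \<open>x\<close> and \<open>y\<close>, hence that of
  \<open>x\<close>. As \<open>a\<close> has degree 1, the remaining relation then says that
  \<open>t - 1\<close> annihilates the coordinate of \<open>u\<close>.\<close>

lemma (in affine_rep) relation_coords:
  fixes a u b v r s x y
  defines "C \<equiv> pronilpotent_completion G"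
  assumes carrier: "{r, s, a, u, b, v, x, y} \<subseteq> carrier C"
    and rel: "r \<otimes>\<^bsub>C\<^esub> s = (x \<otimes>\<^bsub>C\<^esub> y) \<otimes>\<^bsub>C\<^esub> (s \<otimes>\<^bsub>C\<^esub> r)"
      "a \<otimes>\<^bsub>C\<^esub> u = x \<otimes>\<^bsub>C\<^esub> (u \<otimes>\<^bsub>C\<^esub> a)" "b \<otimes>\<^bsub>C\<^esub> v = y \<otimes>\<^bsub>C\<^esub> (v \<otimes>\<^bsub>C\<^esub> b)"
    and deg: "completion_degree \<theta> r = 0" "completion_degree \<theta> s = 0" "completion_degree \<theta> u = 0"
      "completion_degree \<theta> v = 0" "completion_degree \<theta> a = 1" "completion_degree \<theta> b = 0"
    and cancel: "\<And>d. (t - 1) * d = 0 \<Longrightarrow> d = 0"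
  shows "completion_coord \<theta> x = 0" "completion_coord \<theta> y = 0"
    "completion_coord \<theta> (x \<otimes>\<^bsub>C\<^esub> y) = 0" "completion_coord \<theta> u = 0"
proof -
  have m: "r \<in> carrier C" "s \<in> carrier C" "a \<in> carrier C" "u \<in> carrier C" "b \<in> carrier C" "v \<in> carrier C"
    "x \<in> carrier C" "y \<in> carrier C" using carrier by auto
  note degree_mult = completion_degree_mult[folded C_def]
    and coord_mult = completion_coord_mult[folded C_def] and closed = completion_mult_closed[folded C_def]
  have dy: "completion_degree \<theta> y = 0" and dx: "completion_degree \<theta> x = 0"
    using arg_cong[OF rel(3), of "completion_degree \<theta>"] arg_cong[OF rel(2), of "completion_degree \<theta>"]
    by (simp_all add: degree_mult closed m)
  then have dxy: "completion_degree \<theta> (x \<otimes>\<^bsub>C\<^esub> y) = 0" by (simp add: degree_mult m)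
  show y: "completion_coord \<theta> y = 0"
    using arg_cong[OF rel(3), of "completion_coord \<theta>"] by (simp add: coord_mult closed m deg dy)
  show xy: "completion_coord \<theta> (x \<otimes>\<^bsub>C\<^esub> y) = 0"
    using arg_cong[OF rel(1), of "completion_coord \<theta>"] by (simp add: coord_mult[of _ "_ \<otimes>\<^bsub>C\<^esub> _"] coord_mult[of r] coord_mult[of s] closed m deg dxy)
  then show x: "completion_coord \<theta> x = 0" using y by (simp add: coord_mult m dx)
  have "(t - 1) * completion_coord \<theta> u = 0"
    using arg_cong[OF rel(2), of "completion_coord \<theta>"]
    by (simp add: coord_mult closed m deg dx x zpow_def algebra_simps)
  then show "completion_coord \<theta> u = 0" by (rule cancel)
qed

text \<open>At the first index \<open>j\<close> where the selections differ, coefficient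
  \<open>j + 1\<close> of the difference is, up to sign, the leading coefficient of
  \<open>(t - 1) ^ Suc j\<close>. Being 1 or -1, it survives modulo every prime.\<close>

lemma (in affine_rep) engel_prod_separated:
  assumes "a \<in> carrier G" "b \<in> carrier G" "\<theta> a = (1, 0)" "\<theta> b = (0, 1)"
    and t1: "fps_nth t 1 = 1 \<or> fps_nth t 1 = - 1" and "\<epsilon> \<noteq> \<epsilon>'"
  shows "\<exists>k. fps_nth (completion_coord \<theta> (completion_lim (engel_prod a b \<epsilon>))
      - completion_coord \<theta> (completion_lim (engel_prod a b \<epsilon>'))) k \<in> {1, - 1}"
proof -
  define j where "j = (LEAST j. \<epsilon> j \<noteq> \<epsilon>' j)"
  have ex: "\<exists>j. \<epsilon> j \<noteq> \<epsilon>' j" using \<open>\<epsilon> \<noteq> \<epsilon>'\<close> by auto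
  have j: "\<epsilon> j \<noteq> \<epsilon>' j" and least: "\<And>i. i < j \<Longrightarrow> \<epsilon> i = \<epsilon>' i"
    using LeastI_ex[OF ex] not_less_Least unfolding j_def by auto
  have "fps_nth (t - 1) 0 = 0" using fps_X_power_dvd_nth[of 1 "t - 1" 0] X_dvd by simp
  then have "fps_nth ((t - 1) ^ Suc j) (Suc j) = fps_nth t 1 ^ Suc j"
    using startsby_zero_power_nth_same[of "t - 1" "Suc j"] by simp
  then have pm: "fps_nth ((t - 1) ^ Suc j) (Suc j) \<in> {1, - 1}"
    using t1 by (cases "even (Suc j)") (auto simp del: power_Suc)
  have "(\<Sum>i<j. of_bool (\<epsilon> i) * fps_nth ((t - 1) ^ Suc i) (Suc j)) =
    (\<Sum>i<j. of_bool (\<epsilon>' i) * fps_nth ((t - 1) ^ Suc i) (Suc j))"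
    by (intro sum.cong) (use least in auto)
  then have "fps_nth (completion_coord \<theta> (completion_lim (engel_prod a b \<epsilon>))
      - completion_coord \<theta> (completion_lim (engel_prod a b \<epsilon>'))) (Suc j) =
      (of_bool (\<epsilon> j) - of_bool (\<epsilon>' j)) * fps_nth ((t - 1) ^ Suc j) (Suc j)"
    unfolding fps_sub_nth completion_coord_engel_prod_nth[OF assms(1-4)] sum.lessThan_Suc
    by (simp add: algebra_simps del: power_Suc)
  also have "\<dots> \<in> {1, - 1}" using pm j by (cases "\<epsilon> j"; cases "\<epsilon>' j") auto
  finally show ?thesis by blast
qed

text \<open>The two representations share their degrees but use mutually inverse units, so that a
  product of functionals on their coordinates can be invariant. The linear coefficients make
  \<open>t - 1\<close> and \<open>t' - 1\<close> nonzero and separate the products of iterated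
  commutators modulo \<open>p\<close>.\<close>

locale affine_rep_pair = R1: affine_rep G \<theta>1 t t' + R2: affine_rep G \<theta>2 t' t
  for G :: "('a, 'b) monoid_scheme" (structure) and \<theta>1 \<theta>2 :: "'a \<Rightarrow> int \<times> int fps" and t t' +
  fixes a b :: 'a and p :: nat and K :: "int fls set"
  assumes generators [simp]: "a \<in> carrier G" "b \<in> carrier G"
    and theta1: "\<theta>1 a = (1, 0)" "\<theta>1 b = (0, 1)"
    and theta2: "\<theta>2 a = (1, 0)" "\<theta>2 b = (0, 1)"
    and same_degree: "\<And>x. x \<in> carrier G \<Longrightarrow> fst (\<theta>2 x) = fst (\<theta>1 x)"
    and linear_coeff: "fps_nth t 1 = 1 \<or> fps_nth t 1 = - 1" "fps_nth t' 1 = 1 \<or> fps_nth t' 1 = - 1"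
    and prime: "prime p" and subfield: "subfield_modulo (of_nat p) K" and countable_K: "countable K"
    and zpow_mem: "\<And>n. fps_to_fls (zpow t t' n) \<in> K"
begin

section \<open>The invariant cocycle and its values on the cycles\<close>

sublocale subfield_modulo "of_nat p" K by (rule subfield)

abbreviation "C \<equiv> pronilpotent_completion G"

abbreviation degree :: "(nat \<Rightarrow> 'a set) \<Rightarrow> int" where "degree \<equiv> completion_degree \<theta>1"

definition coord1 :: "(nat \<Rightarrow> 'a set) \<Rightarrow> int fls" where "coord1 s = fps_to_fls (completion_coord \<theta>1 s)"
definition coord2 :: "(nat \<Rightarrow> 'a set) \<Rightarrow> int fls" where "coord2 s = fps_to_fls (completion_coord \<theta>2 s)"

definition T :: "int \<Rightarrow> int fls" where "T n = fps_to_fls (zpow t t' n)"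

lemma T_mem: "T n \<in> K" by (simp add: T_def zpow_mem)

lemma T_add: "T (m + n) = T m * T n"
  by (simp add: T_def zpow_add[OF R1.inverse] fls_times_fps_to_fls)

lemma T_0: "T 0 = 1" by (simp add: T_def)

lemma degree2: "s \<in> carrier C \<Longrightarrow> completion_degree \<theta>2 s = degree s"
proof -
  assume s: "s \<in> carrier C"
  obtain f where "f \<in> carrier G" "f \<in> s 1" using R1.completion_nonempty[OF s, of 1] by blast
  then show ?thesis using R1.completion_degree_eq[OF s, of f 1] R2.completion_degree_eq[OF s, of f 1]
      same_degree by simp
qed

lemma coord1_mult: "s \<in> carrier C \<Longrightarrow> u \<in> carrier C \<Longrightarrow>
    coord1 (s \<otimes>\<^bsub>C\<^esub> u) = coord1 s + T (degree s) * coord1 u"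
  by (simp add: coord1_def T_def R1.completion_coord_mult fls_times_fps_to_fls)

lemma coord2_mult: "s \<in> carrier C \<Longrightarrow> u \<in> carrier C \<Longrightarrow>
    coord2 (s \<otimes>\<^bsub>C\<^esub> u) = coord2 s + T (- degree s) * coord2 u"
  by (simp add: coord2_def T_def R2.completion_coord_mult fls_times_fps_to_fls zpow_uminus degree2)

text \<open>
  The form \<open>\<phi> x * \<psi> y'\<close> on pairs \<open>(x, x')\<close>, \<open>(y, y')\<close> is invariant because \<open>t\<close> acts on the first
  coordinates and \<open>t\<^sup>-\<^sup>1\<close> on the second ones.
\<close>

definition cocycle :: "(int fls \<Rightarrow> int fls) \<Rightarrow> (int fls \<Rightarrow> int fls) \<Rightarrow> (nat \<Rightarrow> 'a set) \<times> (nat \<Rightarrow> 'a set) \<Rightarrow> int" where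
  "cocycle \<phi> \<psi> = (\<lambda>(g, h). fls_nth (\<phi> (coord1 g) * \<psi> (T (- degree g) * coord2 h)) 0)"

lemma dvd_fls_nth: "(of_nat p :: int fls) dvd x \<Longrightarrow> int p dvd fls_nth x n"
  using of_int_dvd_fls_nth[of "int p" x] by simp

text \<open>This is \<open>bilinear_cocycle_identity\<close> for \<open>c = T (degree g)\<close>.
  Taking the coefficient at 0 turns divisibility of Laurent series into divisibility of
  integers.\<close>

lemma is_cocycle:
  assumes "linear_modulo \<phi>" "linear_modulo \<psi>"
  shows "is_cocycle_mod (int p) C (cocycle \<phi> \<psi>)"
  unfolding is_cocycle_mod_def
proof (intro ballI)
  fix g h k assume g: "g \<in> carrier C" and h: "h \<in> carrier C" and k: "k \<in> carrier C"
  let ?c = "T (degree g)" and ?c' = "T (- degree g)"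
  let ?x = "coord1 h" and ?y = "T (- degree h) * coord2 k"
    and ?w = "coord1 g" and ?z = "T (- degree g) * coord2 h"
  have "?c * ?c' = 1" using T_add[of "degree g" "- degree g"] T_0 by simp
  from bilinear_cocycle_identity[OF assms T_mem T_mem this, of ?x ?y ?w ?z]
  have main: "int p dvd fls_nth (\<phi> ?x * \<psi> ?y - \<phi> (?w + ?c * ?x) * \<psi> (?c' * ?y) +
      \<phi> ?w * \<psi> (?z + ?c' * ?y) - \<phi> ?w * \<psi> ?z) 0" by (rule dvd_fls_nth)
  have e1: "T (- degree (g \<otimes>\<^bsub>C\<^esub> h)) * coord2 k = ?c' * ?y"
    using T_add[of "- degree g" "- degree h"] by (simp add: R1.completion_degree_mult g h mult.assoc)
  have e2: "T (- degree g) * coord2 (h \<otimes>\<^bsub>C\<^esub> k) = ?z + ?c' * ?y"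
    by (simp add: coord2_mult h k distrib_left)
  show "int p dvd cocycle \<phi> \<psi> (h, k) - cocycle \<phi> \<psi> (g \<otimes>\<^bsub>C\<^esub> h, k) +
      cocycle \<phi> \<psi> (g, h \<otimes>\<^bsub>C\<^esub> k) - cocycle \<phi> \<psi> (g, h)"
    unfolding cocycle_def prod.case coord1_mult[OF g h] e1 e2 using main by simp
qed

definition lift :: "(nat \<Rightarrow> bool) \<Rightarrow> nat \<Rightarrow> 'a set" where
  "lift \<epsilon> = R1.completion_lim (R1.engel_prod a b \<epsilon>)"

text \<open>A single integral cycle serves all moduli and all \<open>\<phi>\<close>,
  \<open>\<psi>\<close>, which are chosen only later. In every term other than those at
  \<open>(R, S)\<close> and \<open>(S, R)\<close> a relevant coordinate is 0 or, for
  \<open>B\<close>, equal to 1, and both functionals kill these modulo \<open>p\<close>.\<close>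

lemma cycle_exists:
  "\<exists>c. (\<forall>m. c \<in> cycles2 m C) \<and>
    (\<forall>\<phi> \<psi>. linear_modulo \<phi> \<longrightarrow> linear_modulo \<psi> \<longrightarrow> of_nat p dvd \<phi> 1 \<longrightarrow> of_nat p dvd \<psi> 1 \<longrightarrow>
      int p dvd pairing c (cocycle \<phi> \<psi>) -
        fls_nth (\<phi> (coord1 (lift \<epsilon>)) * \<psi> (coord2 (lift \<sigma>)) - \<phi> (coord1 (lift \<sigma>)) * \<psi> (coord2 (lift \<epsilon>))) 0)"
proof -
  let ?H = "generate G {a, b}" and ?lim = "R1.completion_lim"
  define L where "L = G\<lparr>carrier := ?H\<rparr>"
  have H: "subgroup ?H G" by (intro R1.generate_is_subgroup) auto
  interpret L: group L unfolding L_def by (rule R1.subgroup_imp_group[OF H])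
  have ab: "a \<in> ?H" "b \<in> ?H" by (auto intro: generate.incl)
  then have abL: "a \<in> carrier L" "b \<in> carrier L" by (simp_all add: L_def)
  have eqL: "L.engel_prod a b \<delta> n = R1.engel_prod a b \<delta> n" for \<delta> n
    unfolding L_def by (rule R1.engel_subgroup(2)[OF H ab])
  have mem: "R1.engel_prod a b \<delta> n \<in> lcs L 1" for \<delta> n
    using L.engel_prod_in_lcs[OF abL] unfolding eqL .
  have coh: "lcs L (Suc n) #>\<^bsub>L\<^esub> R1.engel_prod a b \<delta> (Suc n) = lcs L (Suc n) #>\<^bsub>L\<^esub> R1.engel_prod a b \<delta> n" for \<delta> n
    using L.engel_prod_coherent[OF abL] unfolding eqL .
  let ?r = "R1.engel_prod a b \<epsilon>" and ?s = "R1.engel_prod a b \<sigma>"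
  obtain u v where u1: "\<And>n. u n \<in> lcs G 1" and v1: "\<And>n. v n \<in> lcs G 1"
    and cohs: "R1.lcs_coherent u" "R1.lcs_coherent v" "R1.lcs_coherent ?r" "R1.lcs_coherent ?s"
    and rel: "\<And>n. lcs G n #> (?r n \<otimes> ?s n) =
       lcs G n #> (commutator G a (u n) \<otimes> commutator G b (v n) \<otimes> (?s n \<otimes> ?r n))"
    using R1.completion_commutator_relation[OF generators, folded L_def, of ?r ?s, OF mem coh mem coh] by blast
  note const = R1.lcs_coherent_const[OF generators(1)] R1.lcs_coherent_const[OF generators(2)]
  define x where "x = ?lim (\<lambda>n. commutator G a (u n))"
  define y where "y = ?lim (\<lambda>n. commutator G b (v n))"
  define A where "A = ?lim (\<lambda>_. a)"
  define B where "B = ?lim (\<lambda>_. b)"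
  define U where "U = ?lim u"
  define V where "V = ?lim v"
  define R where "R = lift \<epsilon>"
  define S where "S = lift \<sigma>"
  note defs = x_def y_def A_def B_def U_def V_def R_def S_def lift_def
  have cohs': "R1.lcs_coherent (\<lambda>n. commutator G a (u n))" "R1.lcs_coherent (\<lambda>n. commutator G b (v n))"
    by (intro R1.lcs_coherent_commutator const cohs)+
  have carrier: "{R, S, A, U, B, V, x, y} \<subseteq> carrier C"
    by (simp add: defs R1.completion_lim_closed cohs cohs' const)
  have R_rel: "R \<otimes>\<^bsub>C\<^esub> S = (x \<otimes>\<^bsub>C\<^esub> y) \<otimes>\<^bsub>C\<^esub> (S \<otimes>\<^bsub>C\<^esub> R)"
    using rel by (simp add: defs R1.completion_lim_mult R1.lcs_coherent_mult cohs cohs' const)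
      (simp add: R1.completion_lim_def)
  have A_rel: "A \<otimes>\<^bsub>C\<^esub> U = x \<otimes>\<^bsub>C\<^esub> (U \<otimes>\<^bsub>C\<^esub> A)"
    using R1.commutator_eq[OF generators(1) R1.lcs_coherentD(1)[OF cohs(1)]]
    by (simp add: defs R1.completion_lim_mult R1.lcs_coherent_mult cohs cohs' const)
  have B_rel: "B \<otimes>\<^bsub>C\<^esub> V = y \<otimes>\<^bsub>C\<^esub> (V \<otimes>\<^bsub>C\<^esub> B)"
    using R1.commutator_eq[OF generators(2) R1.lcs_coherentD(1)[OF cohs(2)]]
    by (simp add: defs R1.completion_lim_mult R1.lcs_coherent_mult cohs cohs' const)
  have fst0: "fst (\<theta>1 f) = 0" if "f \<in> lcs G 1" for f using R1.lcs_X_power[of 0] that by auto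
  have deg: "degree R = 0" "degree S = 0" "degree U = 0" "degree V = 0" "degree A = 1" "degree B = 0"
    using fst0 u1 v1 R1.engel_prod_in_lcs[OF generators]
    by (simp_all add: defs R1.completion_degree_lim cohs const theta1 del: One_nat_def)
  have deg2: "completion_degree \<theta>2 R = 0" "completion_degree \<theta>2 S = 0" "completion_degree \<theta>2 U = 0"
    "completion_degree \<theta>2 V = 0" "completion_degree \<theta>2 A = 1" "completion_degree \<theta>2 B = 0"
    using deg degree2 carrier by auto
  \<comment> \<open>Power series over the integers form a domain, and \<open>t - 1\<close> has a
    nonzero linear coefficient.\<close>
  have cancel: "d = 0" if "(t - 1) * d = 0" for d
    using that linear_coeff(1) by auto
  have cancel': "d = 0" if "(t' - 1) * d = 0" for d
    using that linear_coeff(2) by auto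
  note zeros1 = R1.relation_coords[OF carrier R_rel A_rel B_rel deg cancel]
    and zeros2 = R2.relation_coords[OF carrier R_rel A_rel B_rel deg2 cancel']
  have c1: "coord1 x = 0" "coord1 y = 0" "coord1 (x \<otimes>\<^bsub>C\<^esub> y) = 0" "coord1 U = 0" "coord1 B = 1"
    using zeros1 by (simp_all add: coord1_def B_def R1.completion_coord_const theta1)
  have c2: "coord2 U = 0" "coord2 B = 1"
    using zeros2 by (simp_all add: coord2_def B_def R2.completion_coord_const theta2)
  let ?c = "double_commutator_chain C (R, S) (A, U) (B, V) x y"
  have "?c \<in> cycles2 m C" for m
    by (rule double_commutator_chain_cycle[OF R1.completion_mult_closed carrier R_rel A_rel B_rel])
  moreover have "int p dvd pairing ?c (cocycle \<phi> \<psi>) -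
        fls_nth (\<phi> (coord1 R) * \<psi> (coord2 S) - \<phi> (coord1 S) * \<psi> (coord2 R)) 0"
    if \<phi>: "linear_modulo \<phi>" "of_nat p dvd \<phi> 1" and \<psi>: "linear_modulo \<psi>" "of_nat p dvd \<psi> 1" for \<phi> \<psi>
  proof -
    have zero1: "int p dvd cocycle \<phi> \<psi> (g, h)" if "coord1 g = 0 \<or> coord1 g = 1" for g h
      unfolding cocycle_def prod.case
      using that \<phi> linear_modulo_zero[OF \<phi>(1)] by (intro dvd_fls_nth dvd_mult2) auto
    have zero2: "int p dvd cocycle \<phi> \<psi> (g, h)" if "coord2 h = 0 \<or> (coord2 h = 1 \<and> degree g = 0)" for g h
      unfolding cocycle_def prod.case
      using that \<psi> linear_modulo_zero[OF \<psi>(1)] by (intro dvd_fls_nth dvd_mult) (auto simp: T_0)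
    have "pairing ?c (cocycle \<phi> \<psi>) - (cocycle \<phi> \<psi> (R, S) - cocycle \<phi> \<psi> (S, R)) =
      - cocycle \<phi> \<psi> (x \<otimes>\<^bsub>C\<^esub> y, S \<otimes>\<^bsub>C\<^esub> R)
      - (cocycle \<phi> \<psi> (A, U) - cocycle \<phi> \<psi> (U, A) - cocycle \<phi> \<psi> (x, U \<otimes>\<^bsub>C\<^esub> A))
      - (cocycle \<phi> \<psi> (B, V) - cocycle \<phi> \<psi> (V, B) - cocycle \<phi> \<psi> (y, V \<otimes>\<^bsub>C\<^esub> B))
      - cocycle \<phi> \<psi> (x, y)"
      unfolding pairing_double_commutator_chain pairing_commutator_chain by simp
    also have "int p dvd \<dots>"
      using zero1 zero2 c1 c2 deg by (intro dvd_diff) auto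
    finally show ?thesis using deg by (simp add: cocycle_def T_0)
  qed
  ultimately show ?thesis unfolding R_def S_def by blast
qed

lemma not_p_dvd_one: "\<not> int p dvd 1"
  using prime by (auto dest: zdvd_imp_le simp: prime_nat_iff)

lemma coord_separated:
  assumes "\<epsilon> \<noteq> \<epsilon>'"
  shows "\<not> of_nat p dvd coord1 (lift \<epsilon>) - coord1 (lift \<epsilon>')" "\<not> of_nat p dvd coord2 (lift \<epsilon>) - coord2 (lift \<epsilon>')"
proof -
  have no: "\<not> int p dvd c" if "c \<in> {1, - 1}" for c
    using that not_p_dvd_one by auto
  have *: "\<not> of_nat p dvd fps_to_fls d" if "\<exists>k. fps_nth d k \<in> {1, - 1}" for d :: "int fps"
    using that no of_int_dvd_fps_to_fls_iff[of "int p" d] of_int_dvd_fps_iff[of "int p" d] by auto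
  show "\<not> of_nat p dvd coord1 (lift \<epsilon>) - coord1 (lift \<epsilon>')"
    using *[OF R1.engel_prod_separated[OF generators theta1 linear_coeff(1) assms]]
    by (simp add: coord1_def lift_def)
  show "\<not> of_nat p dvd coord2 (lift \<epsilon>) - coord2 (lift \<epsilon>')"
    using *[OF R2.engel_prod_separated[OF generators theta2 linear_coeff(2) assms]]
    by (simp add: coord2_def lift_def)
qed

text \<open>Distinct selections have incongruent coordinates, so the countable set \<open>K\<close>
  excludes only countably many of them for each of the two coordinates.\<close>

lemma exists_transcendental:
  "\<exists>\<sigma>. (\<forall>k \<in> K. \<not> of_nat p dvd coord1 (lift \<sigma>) - k) \<and> (\<forall>k \<in> K. \<not> of_nat p dvd coord2 (lift \<sigma>) - k)"
proof -
  have "countable ({\<sigma>. \<exists>k \<in> K. of_nat p dvd coord1 (lift \<sigma>) - k} \<union> {\<sigma>. \<exists>k \<in> K. of_nat p dvd coord2 (lift \<sigma>) - k})"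
    by (intro countable_Un countable_congruent countable_K coord_separated)
  then have "{\<sigma>. \<exists>k \<in> K. of_nat p dvd coord1 (lift \<sigma>) - k} \<union> {\<sigma>. \<exists>k \<in> K. of_nat p dvd coord2 (lift \<sigma>) - k} \<noteq> UNIV"
    using uncountable_UNIV_nat_bool by metis
  then show ?thesis by blast
qed

lemma H2_uncountable_not_divisible: "\<not> countable (H2 (int p) C) \<and> \<not> H2_Z_divisible C"
proof -
  let ?q = "of_nat p :: int fls"
  obtain \<sigma> where \<sigma>1: "\<And>k. k \<in> K \<Longrightarrow> \<not> ?q dvd coord1 (lift \<sigma>) - k"
    and \<sigma>2: "\<And>k. k \<in> K \<Longrightarrow> \<not> ?q dvd coord2 (lift \<sigma>) - k"
    using exists_transcendental by blast
  let ?s1 = "coord1 (lift \<sigma>)" and ?s2 = "coord2 (lift \<sigma>)"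
  \<comment> \<open>With 0 as the second vector, the independence hypothesis of
    \<open>exists_linear_modulo\<close> reduces to \<open>?s2\<close> lying outside \<open>K\<close>
    modulo \<open>p\<close>.\<close>
  have "\<exists>\<psi>. linear_modulo \<psi> \<and> ?q dvd \<psi> 1 \<and> ?q dvd \<psi> 0 \<and> ?q dvd \<psi> ?s2 - 1"
    by (rule exists_linear_modulo) (use \<sigma>2 in simp)
  then obtain \<psi> where \<psi>: "linear_modulo \<psi>" "?q dvd \<psi> 1" "?q dvd \<psi> ?s2 - 1" by blast
  define c where "c \<epsilon> = (SOME c. (\<forall>m. c \<in> cycles2 m C) \<and>
    (\<forall>\<phi> \<psi>. linear_modulo \<phi> \<longrightarrow> linear_modulo \<psi> \<longrightarrow> ?q dvd \<phi> 1 \<longrightarrow> ?q dvd \<psi> 1 \<longrightarrow>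
      int p dvd pairing c (cocycle \<phi> \<psi>) -
        fls_nth (\<phi> (coord1 (lift \<epsilon>)) * \<psi> ?s2 - \<phi> ?s1 * \<psi> (coord2 (lift \<epsilon>))) 0))" for \<epsilon>
  note c = someI_ex[OF cycle_exists[of _ \<sigma>], folded c_def]
  have cycle: "c \<epsilon> \<in> cycles2 m C" for \<epsilon> m using c[of \<epsilon>] by blast
  have eval_c: "int p dvd pairing (c \<epsilon>) (cocycle \<phi> \<psi>) - fls_nth (\<phi> (coord1 (lift \<epsilon>))) 0"
    if \<phi>: "linear_modulo \<phi>" "?q dvd \<phi> 1" "?q dvd \<phi> ?s1" for \<epsilon> \<phi>
  proof -
    let ?X = "\<phi> (coord1 (lift \<epsilon>))" and ?Y = "\<psi> (coord2 (lift \<epsilon>))"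
    have "int p dvd pairing (c \<epsilon>) (cocycle \<phi> \<psi>) - fls_nth (?X * \<psi> ?s2 - \<phi> ?s1 * ?Y) 0"
      using c[of \<epsilon>] \<phi>(1,2) \<psi>(1,2) by blast
    moreover have "?q dvd ?X * (\<psi> ?s2 - 1) - \<phi> ?s1 * ?Y"
      by (rule dvd_diff[OF dvd_mult[OF \<psi>(3)] dvd_mult2[OF \<phi>(3)]])
    then have "int p dvd fls_nth (?X * (\<psi> ?s2 - 1) - \<phi> ?s1 * ?Y) 0" by (rule dvd_fls_nth)
    ultimately have "int p dvd (pairing (c \<epsilon>) (cocycle \<phi> \<psi>) - fls_nth (?X * \<psi> ?s2 - \<phi> ?s1 * ?Y) 0)
       + fls_nth (?X * (\<psi> ?s2 - 1) - \<phi> ?s1 * ?Y) 0" by (rule dvd_add)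
    then show ?thesis by (simp add: right_diff_distrib)
  qed
  \<comment> \<open>The selections for which \<open>coord1 (lift \<epsilon>) - d\<close> lies in
    \<open>K + K s\<close> modulo \<open>p\<close>; outside this set a functional can kill 1 and
    \<open>?s1\<close> and still take the value 1 on the difference.\<close>
  define bad where "bad d = {\<epsilon>. \<exists>k \<in> (\<lambda>(k, l). d + (k + l * ?s1)) ` (K \<times> K). ?q dvd coord1 (lift \<epsilon>) - k}" for d
  have bad: "countable (bad d)" for d
    unfolding bad_def by (intro countable_congruent coord_separated countable_image countable_SIGMA countable_K)
  have functional: "\<exists>\<phi>. linear_modulo \<phi> \<and> ?q dvd \<phi> 1 \<and> ?q dvd \<phi> ?s1 \<and> ?q dvd \<phi> (coord1 (lift \<epsilon>) - d) - 1"
    if "\<epsilon> \<notin> bad d" for \<epsilon> d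
    by (rule exists_linear_modulo) (use that in \<open>auto simp: bad_def algebra_simps\<close>)
  have "\<not> countable (H2 (int p) C)"
  proof
    assume count: "countable (H2 (int p) C)"
    let ?E = "{(c, c'). c \<in> cycles2 (int p) C \<and> c' \<in> cycles2 (int p) C \<and> homologous2 (int p) C c c'}"
    have H2: "?E `` {c \<epsilon>} \<in> H2 (int p) C" for \<epsilon>
      unfolding H2_def using cycle by (rule quotientI)
    \<comment> \<open>Countably many classes cannot receive uncountably many selections with
      countable fibres. An uncountable fibre is not contained in any \<open>bad\<close> set.\<close>
    have "\<exists>h. uncountable {\<epsilon>. ?E `` {c \<epsilon>} = h}"
    proof (rule ccontr)
      assume "\<nexists>h. uncountable {\<epsilon>. ?E `` {c \<epsilon>} = h}"
      then have "countable (\<Union>h \<in> H2 (int p) C. {\<epsilon>. ?E `` {c \<epsilon>} = h})"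
        using count by (intro countable_UN) auto
      moreover have "(\<Union>h \<in> H2 (int p) C. {\<epsilon>. ?E `` {c \<epsilon>} = h}) = UNIV" using H2 by blast
      ultimately show False using uncountable_UNIV_nat_bool by metis
    qed
    then obtain h where h: "uncountable {\<epsilon>. ?E `` {c \<epsilon>} = h}" by blast
    then have "{\<epsilon>. ?E `` {c \<epsilon>} = h} \<noteq> {}" by (metis countable_empty)
    then obtain \<epsilon>0 where \<epsilon>0: "?E `` {c \<epsilon>0} = h" by blast
    let ?d = "coord1 (lift \<epsilon>0)"
    have "\<not> {\<epsilon>. ?E `` {c \<epsilon>} = h} \<subseteq> bad ?d"
      by (rule notI, rule notE[OF h], rule countable_subset[OF _ bad])
    then obtain \<epsilon> where \<epsilon>: "?E `` {c \<epsilon>} = h" "\<epsilon> \<notin> bad ?d" by blast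
    obtain \<phi> where \<phi>: "linear_modulo \<phi>" "?q dvd \<phi> 1" "?q dvd \<phi> ?s1" "?q dvd \<phi> (coord1 (lift \<epsilon>) - ?d) - 1"
      using functional[OF \<epsilon>(2)] by blast
    have "homologous2 (int p) C (c \<epsilon>0) (c \<epsilon>0)"
      unfolding homologous2_def by (rule bexI[of _ "\<lambda>_. 0"]) (auto simp: chains3_def bd3_def)
    then have "c \<epsilon>0 \<in> ?E `` {c \<epsilon>0}" using cycle by blast
    then have "homologous2 (int p) C (c \<epsilon>) (c \<epsilon>0)" using \<epsilon>(1) \<epsilon>0 by blast
    then have hom: "int p dvd pairing (c \<epsilon>) (cocycle \<phi> \<psi>) - pairing (c \<epsilon>0) (cocycle \<phi> \<psi>)"
      using cycle[of _ 0] homologous2_pairing[OF _ _ _ is_cocycle[OF \<phi>(1) \<psi>(1)] dvd_refl, of "c \<epsilon>" "c \<epsilon>0"]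
      by (simp add: cycles2_def)
    have "int p dvd fls_nth ((\<phi> (coord1 (lift \<epsilon>) - ?d) - (\<phi> (coord1 (lift \<epsilon>)) - \<phi> ?d))
        - (\<phi> (coord1 (lift \<epsilon>) - ?d) - 1)) 0"
      by (rule dvd_fls_nth[OF dvd_diff[OF linear_modulo_diff[OF \<phi>(1)] \<phi>(4)]])
    \<comment> \<open>The two evaluations, the equality of the classes and the additivity of
      \<open>\<phi>\<close> combine to an expression equal to -1.\<close>
    from dvd_diff[OF dvd_diff[OF dvd_diff[OF eval_c[OF \<phi>(1-3), of \<epsilon>] eval_c[OF \<phi>(1-3), of \<epsilon>0]] hom] this]
    show False using not_p_dvd_one by simp
  qed
  moreover have "\<not> H2_Z_divisible C"
  proof
    assume "H2_Z_divisible C"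
    have "bad 0 \<noteq> UNIV" using bad uncountable_UNIV_nat_bool by metis
    then obtain \<epsilon> where \<epsilon>: "\<epsilon> \<notin> bad 0" by blast
    obtain \<phi> where \<phi>: "linear_modulo \<phi>" "?q dvd \<phi> 1" "?q dvd \<phi> ?s1" "?q dvd \<phi> (coord1 (lift \<epsilon>)) - 1"
      using functional[OF \<epsilon>] by auto
    have "int p \<ge> 1" using prime_gt_0_nat[OF prime] by linarith
    then obtain d where d: "d \<in> cycles2 0 C" "homologous2 0 C (c \<epsilon>) (\<lambda>y. int p * d y)"
      using \<open>H2_Z_divisible C\<close> cycle unfolding H2_Z_divisible_def by blast
    have "{z. int p * d z \<noteq> 0} = {z. d z \<noteq> 0}" using prime_gt_0_nat[OF prime] by auto
    then have "(\<lambda>y. int p * d y) \<in> chains2 C" using d(1) by (simp add: cycles2_def chains2_def)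
    \<comment> \<open>Integral homology is the modulus 0, which \<open>p\<close> divides, so the
      cocycle modulo \<open>p\<close> also detects integral classes; it vanishes modulo
      \<open>p\<close> on multiples of \<open>p\<close>.\<close>
    then have "int p dvd pairing (c \<epsilon>) (cocycle \<phi> \<psi>) - pairing (\<lambda>y. int p * d y) (cocycle \<phi> \<psi>)"
      using cycle[of \<epsilon> 0] homologous2_pairing[OF _ _ d(2) is_cocycle[OF \<phi>(1) \<psi>(1)] dvd_0_right]
      by (simp add: cycles2_def)
    moreover have "int p dvd pairing (\<lambda>y. int p * d y) (cocycle \<phi> \<psi>)"
      unfolding pairing_def by (intro dvd_sum dvd_mult2) simp
    ultimately have "int p dvd pairing (c \<epsilon>) (cocycle \<phi> \<psi>)" by (metis dvd_diff_left_iff)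
    from dvd_diff[OF dvd_diff[OF this eval_c[OF \<phi>(1-3), of \<epsilon>]] dvd_fls_nth[OF \<phi>(4), of 0]]
    show False using not_p_dvd_one by simp
  qed
  ultimately show ?thesis by blast
qed

end

section \<open>Two basis elements and the two representations of the free group\<close>

lemma non_cyclic_free_basis:
  assumes "group F" and "free_basis F B" and "\<not> cyclic_group F"
  shows "\<exists>a \<in> B. \<exists>b \<in> B. a \<noteq> b"
proof (rule ccontr)
  assume single: "\<not> ?thesis"
  interpret F: group F by fact
  have B: "B \<subseteq> carrier F" "generate F B = carrier F" using assms(2) by (simp_all add: free_basis_def)
  consider "B = {}" | x where "B = {x}" using single by blast
  then show False
  proof cases
    case 1
    then have "generate F {\<one>\<^bsub>F\<^esub>} = carrier F" using B F.generate_one F.generate_empty by simp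
    then show ?thesis using assms(3) unfolding cyclic_group_def by blast
  next
    case 2
    then show ?thesis using assms(3) B unfolding cyclic_group_def by blast
  qed
qed

theorem theorem2:
  fixes F :: "('a, 'b) monoid_scheme" and B :: "'a set" and p :: nat
  assumes "group F"
    and "finite B" and "free_basis F B"
    and "\<not> cyclic_group F"
    and "prime p" and "p \<noteq> 2"
  shows "\<not> countable (H2 (int p) (pronilpotent_completion F))
         \<and> \<not> H2_Z_divisible (pronilpotent_completion F)"
proof -
  interpret F: group F by fact
  obtain a b where ab: "a \<in> B" "b \<in> B" "a \<noteq> b" using non_cyclic_free_basis assms by blast
  have B: "B \<subseteq> carrier F" "generate F B = carrier F" using assms(3) by (simp_all add: free_basis_def)
  define t :: "int fps" where "t = 1 + fps_X"
  define t' where "t' = fps_right_inverse t 1"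
  have tt': "t * t' = 1" unfolding t'_def by (rule fps_right_inverse) (simp add: t_def)
  then have t't: "t' * t = 1" by (simp add: mult.commute)
  \<comment> \<open>This gives both the divisibility of \<open>t' - 1\<close> by
    \<open>fps_X\<close> and its linear coefficient.\<close>
  have t'1: "t' - 1 = fps_X * (- t')" using tt' by (simp add: t_def algebra_simps)
  have "fps_nth (t * t') 0 = 1" using tt' by simp
  then have "fps_nth t' 0 = 1" by (simp add: t_def)
  then have "fps_nth (t' - 1) 1 = - 1" unfolding t'1 by simp
  then have coeff: "fps_nth t' 1 = - 1" by simp
  define h :: "'a \<Rightarrow> int \<times> int fps" where "h x = (if x = a then (1, 0) else if x = b then (0, 1) else (0, 0))" for x
  have rep: "\<exists>\<theta> \<in> hom F (affine_group s s'). \<forall>x \<in> B. \<theta> x = h x" if "s * s' = 1" for s s'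
    by (rule free_basis_hom[OF assms(1) group_affine_group[OF that] assms(3)]) (simp add: affine_group_def)
  obtain \<theta>1 where \<theta>1: "\<theta>1 \<in> hom F (affine_group t t')" "\<And>x. x \<in> B \<Longrightarrow> \<theta>1 x = h x" using rep[OF tt'] by blast
  obtain \<theta>2 where \<theta>2: "\<theta>2 \<in> hom F (affine_group t' t)" "\<And>x. x \<in> B \<Longrightarrow> \<theta>2 x = h x" using rep[OF t't] by blast
  interpret R1: affine_rep F \<theta>1 t t'
    by unfold_locales (use \<theta>1 tt' in \<open>simp_all add: t_def\<close>)
  interpret R2: affine_rep F \<theta>2 t' t
    by unfold_locales (use \<theta>2 t't t'1 in simp_all)
  have inv: "fst (\<theta>1 (inv\<^bsub>F\<^esub> x)) = - fst (\<theta>1 x)" "fst (\<theta>2 (inv\<^bsub>F\<^esub> x)) = - fst (\<theta>2 x)" if "x \<in> carrier F" for x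
    using that R1.fst_mult[of "inv\<^bsub>F\<^esub> x" x] R2.fst_mult[of "inv\<^bsub>F\<^esub> x" x] R1.fst_one R2.fst_one by simp_all
  \<comment> \<open>In both representations the degree is the exponent sum of \<open>a\<close>,
    determined by the common values \<open>h\<close> on the basis.\<close>
  have same: "fst (\<theta>2 x) = fst (\<theta>1 x)" if "x \<in> generate F B" for x
    using that
  proof (induction rule: generate.induct)
    case (eng x y)
    then show ?case using B by (simp add: R1.fst_mult R2.fst_mult)
  next
    case (inv x)
    then have "x \<in> carrier F" using B by blast
    then show ?case using \<open>\<And>x. x \<in> carrier F \<Longrightarrow> fst (\<theta>1 (inv\<^bsub>F\<^esub> x)) = - fst (\<theta>1 x)\<close>
        \<open>\<And>x. x \<in> carrier F \<Longrightarrow> fst (\<theta>2 (inv\<^bsub>F\<^esub> x)) = - fst (\<theta>2 x)\<close> inv \<theta>1(2) \<theta>2(2) by simp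
  qed (simp_all add: R1.fst_one R2.fst_one \<theta>1(2) \<theta>2(2))
  \<comment> \<open>The integer powers of \<open>t\<close> form a countable set; their membership in
    \<open>K\<close> makes \<open>K\<close>-linear maps compatible with the action.\<close>
  obtain K where K: "countable K" "range (\<lambda>n. fps_to_fls (zpow t t' n)) \<subseteq> K" "subfield_modulo (of_nat p :: int fls) K"
    using exists_countable_subfield_modulo[OF inverse_modulo_prime_fls[OF assms(5)],
        of "range (\<lambda>n. fps_to_fls (zpow t t' n))"] by auto
  interpret affine_rep_pair F \<theta>1 \<theta>2 t t' a b p K
  proof (rule affine_rep_pair.intro[OF R1.affine_rep_axioms R2.affine_rep_axioms affine_rep_pair_axioms.intro])
    show "a \<in> carrier F" "b \<in> carrier F" using ab B by auto
    show "\<theta>1 a = (1, 0)" "\<theta>1 b = (0, 1)" "\<theta>2 a = (1, 0)" "\<theta>2 b = (0, 1)"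
      using ab by (simp_all add: \<theta>1(2) \<theta>2(2) h_def)
    show "fst (\<theta>2 x) = fst (\<theta>1 x)" if "x \<in> carrier F" for x using same that B by simp
    show "fps_nth t 1 = 1 \<or> fps_nth t 1 = - 1" by (simp add: t_def)
  qed (use coeff assms(5) K in auto)
  show ?thesis by (rule H2_uncountable_not_divisible)
qed

end
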